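(* The function $\phi\colon \mathbf{G}\to\mathbb{C}$ is a 4-invariant and satisfies the graph Chmutov–Varchenko relations at $p=\frac38$. Consequently it extends the specialization of the $\mathfrak{sl}(2)$-weight system $w_{\mathfrak{sl}(2)}$ at $c=\frac38$ from the set of intersection graphs of chord diagrams to all of $\mathbf{G}$; that is, for every chord diagram $D$ with intersection graph $\Gamma_D$, $$\phi(\Gamma_D)=w_{\mathfrak{sl}(2)}(D)\big|_{c=3/8}.$$
   Context: **Graphs and $\phi$.** All graphs are finite and simple; $\mathbf{G}$ is the set of isomorphism classes of finite simple graphs. $V(G)$, $E(G)$ are the vertex and edge sets of $G$. For $E'\subset E(G)$, $G|_{E'}$ is the spanning subgraph of $G$ with edge set $E'$ (same vertices). $\chi_3(H)$ is the number of proper colorings of the vertices of $H$ in three colors (maps $V(H)\to\{1,2,3\}$ taking different values at the ends of each edge). Define $$\phi(G)=2^{-3|V(G)|}\sum_{E'\subset E(G)}(-2)^{|E'|}\chi_3(G|_{E'}).$$ $\triangle$ denotes symmetric difference of sets. **4-invariants.** Let $H$ be a finite simple graph with vertex set $W$ and let $a,b\subset W$ (not necessarily disjoint). Denote by $[H;a,b]_1$ (resp. $[H;a,b]_0$) the graph obtained from $H$ by adding two new vertices, the first adjacent in $W$ exactly to the vertices of $a$, the second adjacent in $W$ exactly to the vertices of $b$, with the two new vertices adjacent (resp. not adjacent) to each other. A function $g\colon\mathbf{G}\to\mathbb{C}$ is a *4-invariant* if for all such $H,a,b$ $$g([H;a,b]_1)-g([H;a,b]_0)=g([H;a\triangle b,b]_1)-g([H;a\triangle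 b,b]_0).$$ **Graph Chmutov–Varchenko relations at $p\in\mathbb{C}$.** A function $g\colon\mathbf{G}\to\mathbb{C}$ satisfies them if: 1. (Normalization) $g$ equals $p$ on the graph with one vertex and no edges. 2. (Multiplicativity) $g(G_1\sqcup G_2)=g(G_1)g(G_2)$ for all $G_1,G_2\in\mathbf{G}$. 3. (Leaf deletion) If $G$ has a vertex of degree 1 and $G'$ is obtained by removing this vertex together with its edge, then $g(G)=(p-\frac12)g(G')$. 4. (Graph 6T-relations) For a finite simple graph $H$ with vertex set $W$, subsets $x,y,z\subset W$ (not necessarily disjoint), and $i,j,k\in\{0,1\}$, let $T_{i,j,k}$ be the graph obtained from $H$ by adding three new vertices $A,B,C$ whose neighborhoods in $W$ are $x,y,z$ respectively, where $AB$ is an edge iff $i=1$, $BC$ is an edge iff $j=1$, and $AC$ is an edge iff $k=1$. Then for all $H,x,y,z$ $$g(T_{1,1,0})-g(T_{0,1,0})-g(T_{1,0,0})+g(T_{0,0,0})=\tfrac12 g([H;y,x\triangle y\triangle z]_0)-\tfrac12 g([H;x\triangle y,y\triangle z]_1),$$ $$g(T_{1,1,1})-g(T_{0,1,1})-g(T_{1,0,1})+g(T_{0,0,1})=\tfrac12 g([H;y,x\triangle y\triangle z]_0)-\tfrac12 g([H;x\triangle y,y\triangle z]_0).$$ **Chord diagrams.** A chord diagram of order $n\ge 0$ is a set of $2n$ distinct points on an oriented circle together with a complete pairing of these points (the pairs are called chords), considered up to orientation-preserving diffeomorphism of the circle. It can be encoded by a cyclic word in which each letter (chord) occurs exactly twice,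 read along the orientation of the circle. Two chords intersect if their endpoints interlace. The intersection graph $\Gamma_D$ of $D$ has the chords of $D$ as vertices, two being adjacent iff the chords intersect. A product $D_1D_2$ of chord diagrams is any diagram obtained by breaking each circle at a point that is not a chord endpoint and gluing the circles together respecting orientations (i.e. concatenating linear words representing $D_1$ and $D_2$). **The $\mathfrak{sl}(2)$-weight system** (for the Killing form) is the unique function $w=w_{\mathfrak{sl}(2)}$ from the set of chord diagrams to $\mathbb{C}[c]$ satisfying: 1. $w$ of the diagram with one chord equals $c$. 2. $w(D_1D_2)=w(D_1)w(D_2)$ for any diagram $D_1D_2$ glued from $D_1$ and $D_2$. 3. If $D$ has a leaf (a chord intersecting exactly one other chord) and $D'$ is the result of deleting the leaf, then $w(D)=(c-\frac12)w(D')$. 4. (6T-relations) For all words $P,Q,R,S$ not involving the letters $a,b,c$ (used here as names of chords) such that every letter of $PQRS$ occurs in it exactly twice, with cyclic words standing for chord diagrams: $$w(ab\,P\,ca\,Q\,c\,R\,b\,S)-w(ba\,P\,ca\,Q\,c\,R\,b\,S)-w(ab\,P\,ac\,Q\,c\,R\,b\,S)+w(ba\,P\,ac\,Q\,c\,R\,b\,S)=\tfrac12 w(b\,P\,b\,Q\,c\,R\,c\,S)-\tfrac12 w(b\,P\,c\,Q\,b\,R\,c\,S),$$ $$w(ab\,P\,ca\,Q\,b\,R\,c\,S)-w(ba\,P\,ca\,Q\,b\,R\,c\,S)-w(ab\,P\,ac\,Q\,b\,R\,c\,S)+w(ba\,P\,ac\,Q\,b\,R\,c\,S)=\tfrac12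 w(b\,P\,b\,Q\,c\,R\,c\,S)-\tfrac12 w(b\,P\,c\,Q\,c\,R\,b\,S).$$ *)

theory Defs
  imports
    Complex_Main
    "HOL-Library.FuncSet"
    "HOL-Computational_Algebra.Polynomial"
begin

text \<open>
  Every isomorphism class of finite graphs has a representative with vertices in \<^typ>\<open>nat\<close>.  A
  function on isomorphism classes is a function on such representatives, i.e. on pairs of a vertex
  set and an edge set, that takes equal values on isomorphic graphs; its values at pairs that are
  not finite simple graphs play no role.
\<close>

type_synonym graph = "nat set \<times> nat set set"

definition simple_graph :: "graph \<Rightarrow> bool" where
  "simple_graph G \<longleftrightarrow> finite (fst G) \<and> snd G \<subseteq> {e. e \<subseteq> fst G \<and> card e = 2}"

definition graph_iso :: "graph \<Rightarrow> graph \<Rightarrow> bool" where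
  "graph_iso G H \<longleftrightarrow> (\<exists>f. bij_betw f (fst G) (fst H) \<and> snd H = (\<lambda>e. f ` e) ` snd G)"

definition graph_function :: "(graph \<Rightarrow> complex) \<Rightarrow> bool" where
  "graph_function g \<longleftrightarrow>
     (\<forall>G H. simple_graph G \<longrightarrow> simple_graph H \<longrightarrow> graph_iso G H \<longrightarrow> g G = g H)"

definition chi3 :: "graph \<Rightarrow> nat" where
  "chi3 H = card {f \<in> fst H \<rightarrow>\<^sub>E {1, 2, 3::nat}. \<forall>u v. {u, v} \<in> snd H \<longrightarrow> f u \<noteq> f v}"

definition phi :: "graph \<Rightarrow> complex" where
  "phi G = (1 / 2 ^ (3 * card (fst G))) *
     (\<Sum>E' \<in> Pow (snd G). (-2) ^ card E' * of_nat (chi3 (fst G, E')))"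

definition star :: "nat \<Rightarrow> nat set \<Rightarrow> nat set set" where
  "star u a = (\<lambda>x. {u, x}) ` a"

text \<open>
  In \<open>add2\<close> and \<open>add3\<close> the names of the new vertices are explicit parameters, required to be
  distinct and fresh where these functions are used.  Since only isomorphism-invariant functions
  are applied to the results, the choice of names is immaterial.
\<close>

definition add2 :: "nat \<Rightarrow> nat \<Rightarrow> graph \<Rightarrow> nat set \<Rightarrow> nat set \<Rightarrow> bool \<Rightarrow> graph" where
  "add2 u v H a b i =
     (fst H \<union> {u, v}, snd H \<union> star u a \<union> star v b \<union> (if i then {{u, v}} else {}))"

definition add3 ::
  "nat \<Rightarrow> nat \<Rightarrow> nat \<Rightarrow> graph \<Rightarrow> nat set \<Rightarrow> nat set \<Rightarrow> nat set \<Rightarrow> bool \<Rightarrow> bool \<Rightarrow> bool \<Rightarrow> graph" where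
  "add3 A B C H x y z i j k =
     (fst H \<union> {A, B, C},
      snd H \<union> star A x \<union> star B y \<union> star C z
        \<union> (if i then {{A, B}} else {}) \<union> (if j then {{B, C}} else {})
        \<union> (if k then {{A, C}} else {}))"

definition four_invariant :: "(graph \<Rightarrow> complex) \<Rightarrow> bool" where
  "four_invariant g \<longleftrightarrow> graph_function g \<and>
     (\<forall>H a b u v. simple_graph H \<and> a \<subseteq> fst H \<and> b \<subseteq> fst H \<and> u \<notin> fst H \<and> v \<notin> fst H \<and> u \<noteq> v \<longrightarrow>
        g (add2 u v H a b True) - g (add2 u v H a b False) =
        g (add2 u v H (sym_diff a b) b True) - g (add2 u v H (sym_diff a b) b False))"

definition graph_6T :: "(graph \<Rightarrow> complex) \<Rightarrow> bool" where
  "graph_6T g \<longleftrightarrow>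
     (\<forall>H x y z A B C. simple_graph H \<and> x \<subseteq> fst H \<and> y \<subseteq> fst H \<and> z \<subseteq> fst H \<and>
        A \<notin> fst H \<and> B \<notin> fst H \<and> C \<notin> fst H \<and> A \<noteq> B \<and> B \<noteq> C \<and> A \<noteq> C \<longrightarrow>
        (let T = add3 A B C H x y z; xyz = sym_diff (sym_diff x y) z in
          g (T True True False) - g (T False True False)
            - g (T True False False) + g (T False False False) =
          1/2 * g (add2 A B H y xyz False)
            - 1/2 * g (add2 A B H (sym_diff x y) (sym_diff y z) True) \<and>
          g (T True True True) - g (T False True True)
            - g (T True False True) + g (T False False True) =
          1/2 * g (add2 A B H y xyz False)
            - 1/2 * g (add2 A B H (sym_diff x y) (sym_diff y z) False)))"

definition graph_CV_relations :: "complex \<Rightarrow> (graph \<Rightarrow> complex) \<Rightarrow> bool" where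
  "graph_CV_relations p g \<longleftrightarrow> graph_function g \<and>
     (\<forall>v. g ({v}, {}) = p) \<and>
     (\<forall>G1 G2. simple_graph G1 \<and> simple_graph G2 \<and> fst G1 \<inter> fst G2 = {} \<longrightarrow>
        g (fst G1 \<union> fst G2, snd G1 \<union> snd G2) = g G1 * g G2) \<and>
     (\<forall>G v. simple_graph G \<and> v \<in> fst G \<and> card {e \<in> snd G. v \<in> e} = 1 \<longrightarrow>
        g G = (p - 1/2) * g (fst G - {v}, {e \<in> snd G. v \<notin> e})) \<and>
     graph_6T g"

text \<open>
  A chord diagram is represented by a linear word in which every letter (chord) occurs exactly
  twice.  Two words represent the same diagram iff they agree up to rotation and renaming of the
  letters, so a function on chord diagrams is a function on words invariant under both operations.
\<close>

definition chord_diagram :: "nat list \<Rightarrow> bool" where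
  "chord_diagram D \<longleftrightarrow> (\<forall>a \<in> set D. count_list D a = 2)"

definition same_diagram :: "nat list \<Rightarrow> nat list \<Rightarrow> bool" where
  "same_diagram D D' \<longleftrightarrow> (\<exists>f k. inj_on f (set D) \<and> D' = map f (rotate k D))"

definition diagram_function :: "(nat list \<Rightarrow> complex poly) \<Rightarrow> bool" where
  "diagram_function w \<longleftrightarrow>
     (\<forall>D D'. chord_diagram D \<longrightarrow> chord_diagram D' \<longrightarrow> same_diagram D D' \<longrightarrow> w D = w D')"

definition chords_intersect :: "nat list \<Rightarrow> nat \<Rightarrow> nat \<Rightarrow> bool" where
  "chords_intersect D a b \<longleftrightarrow>
     filter (\<lambda>x. x = a \<or> x = b) D \<in> {[a, b, a, b], [b, a, b, a]}"

definition intersection_graph :: "nat list \<Rightarrow> graph" where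
  "intersection_graph D = (set D, {{a, b} | a b. chords_intersect D a b})"

definition chord_6T :: "(nat list \<Rightarrow> complex poly) \<Rightarrow> bool" where
  "chord_6T w \<longleftrightarrow>
     (\<forall>P Q R S a b c.
        chord_diagram (P @ Q @ R @ S) \<and> a \<notin> set (P @ Q @ R @ S) \<and> b \<notin> set (P @ Q @ R @ S) \<and>
        c \<notin> set (P @ Q @ R @ S) \<and> a \<noteq> b \<and> b \<noteq> c \<and> a \<noteq> c \<longrightarrow>
        w ([a,b] @ P @ [c,a] @ Q @ [c] @ R @ [b] @ S) - w ([b,a] @ P @ [c,a] @ Q @ [c] @ R @ [b] @ S)
          - w ([a,b] @ P @ [a,c] @ Q @ [c] @ R @ [b] @ S)
          + w ([b,a] @ P @ [a,c] @ Q @ [c] @ R @ [b] @ S) =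
        smult (1/2) (w ([b] @ P @ [b] @ Q @ [c] @ R @ [c] @ S))
          - smult (1/2) (w ([b] @ P @ [c] @ Q @ [b] @ R @ [c] @ S)) \<and>
        w ([a,b] @ P @ [c,a] @ Q @ [b] @ R @ [c] @ S) - w ([b,a] @ P @ [c,a] @ Q @ [b] @ R @ [c] @ S)
          - w ([a,b] @ P @ [a,c] @ Q @ [b] @ R @ [c] @ S)
          + w ([b,a] @ P @ [a,c] @ Q @ [b] @ R @ [c] @ S) =
        smult (1/2) (w ([b] @ P @ [b] @ Q @ [c] @ R @ [c] @ S))
          - smult (1/2) (w ([b] @ P @ [c] @ Q @ [c] @ R @ [b] @ S)))"

text \<open>
  The defining properties of the weight system; the variable \<open>c\<close> of the polynomial ring is
  \<^term>\<open>[:0, 1:]\<close>.  The weight system is the only function on chord diagrams with these properties,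
  and is referred to below as any \<open>w\<close> satisfying the predicate (as a function on all lists, such a
  \<open>w\<close> is arbitrary outside \<open>chord_diagram\<close>).
\<close>

definition sl2_weight_system :: "(nat list \<Rightarrow> complex poly) \<Rightarrow> bool" where
  "sl2_weight_system w \<longleftrightarrow> diagram_function w \<and>
     (\<forall>a. w [a, a] = [:0, 1:]) \<and>
     (\<forall>D1 D2. chord_diagram D1 \<and> chord_diagram D2 \<and> set D1 \<inter> set D2 = {} \<longrightarrow>
        w (D1 @ D2) = w D1 * w D2) \<and>
     (\<forall>D a. chord_diagram D \<and> a \<in> set D \<and> card {b. chords_intersect D a b} = 1 \<longrightarrow>
        w D = ([:0, 1:] - [:1/2:]) * w (removeAll a D)) \<and>
     chord_6T w"

end

theory Submission
  imports Defs
begin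

text \<open>
  Interchanging the two summations in \<^const>\<open>phi\<close> turns it into a spin model.  For a fixed map
  \<open>f\<close> from the vertices to three colours, only edge sets consisting of bichromatic edges contribute,
  and they contribute \<open>(1 + (-2)) ^ m\<close>, where \<open>m\<close> is the number of bichromatic edges of the graph.
  So \<^const>\<open>phi\<close> is, up to the factor \<open>8 ^ n\<close>, the sum over all colourings of a product of signs, one
  for each edge, negative iff the edge is bichromatic (\<open>phi_eq_colour_sum\<close>).  These are the signs with
  which Pauli matrices commute or anticommute.

  The part of the graph outside the two or three distinguished vertices of a relation enters this
  sum only through the sign that a neighbourhood gives to each colour of the distinguished vertex.
  Multiplying such sign vectors corresponds to taking symmetric differences of neighbourhoods, and
  each of them is a character of the Klein four-group, restricted to its three nontrivial elements
  (\<open>colour_character_nbr_sign\<close>).  After fixing the colouring of the rest, the 4-term and 6-term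
  relations become identities between sums over the colours of the distinguished vertices
  (\<open>kernel2_4T\<close>, \<open>kernel3_6T\<close>), which hold for all such characters.

  For chord diagrams, a chord \<open>a\<close> meets exactly the chords that occur an odd number of times between
  the two ends of \<open>a\<close>; this translates the diagrams in the 6T-relations into the graphs in the graph
  6T-relations (\<open>chord_6T_phi\<close>).  It remains to see that the relations determine a weight system
  (\<open>chord_CV_relations_unique\<close>).  Every nonempty diagram has a chord \<open>a\<close> and an arc between its ends
  on which no chord has both ends.  If the arc contains no end, \<open>a\<close> is isolated; if it contains
  one, \<open>a\<close> is a leaf; otherwise the 6T-relation applied to \<open>a\<close> and the outermost two ends on the arc
  expresses the diagram by diagrams with a shorter arc or with fewer chords.
\<close>

section \<open>The sum over colourings\<close>

definition colour_sign :: "nat \<Rightarrow> nat \<Rightarrow> complex" where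
  "colour_sign c d = (if c = d then 1 else -1)"

definition edge_sign :: "(nat \<Rightarrow> nat) \<Rightarrow> nat set \<Rightarrow> complex" where
  "edge_sign f e = (if \<forall>x\<in>e. \<forall>y\<in>e. f x = f y then 1 else -1)"

lemma edge_sign_pair: "edge_sign f {u, v} = colour_sign (f u) (f v)"
  by (auto simp: edge_sign_def colour_sign_def)

abbreviation colourings :: "nat set \<Rightarrow> (nat \<Rightarrow> nat) set" where
  "colourings V \<equiv> V \<rightarrow>\<^sub>E {1, 2, 3}"

text \<open>
  The observable \<open>F\<close> lets the sum over the colour of a vertex be carried out separately from the sum
  over the colours of all other vertices.
\<close>

definition colour_sum :: "graph \<Rightarrow> ((nat \<Rightarrow> nat) \<Rightarrow> complex) \<Rightarrow> complex" where
  "colour_sum G F = (\<Sum>f\<in>colourings (fst G). (\<Prod>e\<in>snd G. edge_sign f e) * F f)"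

lemma simple_graph_edge:
  assumes "simple_graph G" "e \<in> snd G"
  obtains u v where "e = {u, v}" "u \<noteq> v" "u \<in> fst G" "v \<in> fst G"
proof -
  from assms have "e \<subseteq> fst G" "card e = 2"
    by (auto simp: simple_graph_def)
  with that show ?thesis
    by (auto simp: card_2_iff)
qed

lemma simple_graph_finite_edges: "simple_graph G \<Longrightarrow> finite (snd G)"
  unfolding simple_graph_def
  by (rule finite_subset[of _ "Pow (fst G)"]) auto

text \<open>
  This form of properness makes the edge sets for which a given map is a proper colouring into a
  power set, over which the sum of \<open>(-2) ^ card E'\<close> is elementary.
\<close>

lemma proper_colouring_iff:
  assumes "simple_graph G" "E' \<subseteq> snd G"
  shows "(\<forall>u v. {u, v} \<in> E' \<longrightarrow> f u \<noteq> f v) \<longleftrightarrow> E' \<subseteq> {e \<in> snd G. edge_sign f e = -1}"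
proof
  assume proper: "\<forall>u v. {u, v} \<in> E' \<longrightarrow> f u \<noteq> f v"
  show "E' \<subseteq> {e \<in> snd G. edge_sign f e = -1}"
  proof
    fix e assume e: "e \<in> E'"
    with assms obtain u v where "e = {u, v}"
      by (meson simple_graph_edge subsetD)
    with e proper assms show "e \<in> {e \<in> snd G. edge_sign f e = -1}"
      by (auto simp: edge_sign_pair colour_sign_def)
  qed
next
  assume "E' \<subseteq> {e \<in> snd G. edge_sign f e = -1}"
  then show "\<forall>u v. {u, v} \<in> E' \<longrightarrow> f u \<noteq> f v"
    by (force simp: edge_sign_pair colour_sign_def)
qed

lemma sum_Pow_minus_two:
  assumes "finite B"
  shows "(\<Sum>E'\<in>Pow B. (-2) ^ card E') = ((-1) ^ card B :: complex)"
  using prod_add[OF assms, of "\<lambda>_. -2 :: complex" "\<lambda>_. 1"] by simp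

lemma prod_edge_sign:
  assumes "finite E"
  shows "(\<Prod>e\<in>E. edge_sign f e) = (-1) ^ card {e \<in> E. edge_sign f e = -1}"
proof -
  have "(\<Prod>e\<in>E. edge_sign f e) = (\<Prod>e\<in>E. if edge_sign f e = -1 then -1 else 1)"
    by (rule prod.cong) (auto simp: edge_sign_def)
  also have "\<dots> = (-1) ^ card {e \<in> E. edge_sign f e = -1}"
    using assms by (simp add: prod.If_cases Int_def)
  finally show ?thesis .
qed

lemma phi_eq_colour_sum:
  assumes "simple_graph G"
  shows "phi G = colour_sum G (\<lambda>_. 1) / 8 ^ card (fst G)"
proof -
  let ?E = "snd G" and ?C = "colourings (fst G)"
  have finE: "finite ?E" using assms by (rule simple_graph_finite_edges)
  have finC: "finite ?C" using assms by (auto simp: simple_graph_def intro: finite_PiE)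
  have "(\<Sum>E'\<in>Pow ?E. (-2) ^ card E' * of_nat (chi3 (fst G, E'))) =
      (\<Sum>E'\<in>Pow ?E. \<Sum>f\<in>?C. if E' \<subseteq> {e \<in> ?E. edge_sign f e = -1} then (-2) ^ card E' else (0::complex))"
  proof (rule sum.cong[OF refl])
    fix E' assume "E' \<in> Pow ?E"
    then have "chi3 (fst G, E') = card {f \<in> ?C. E' \<subseteq> {e \<in> ?E. edge_sign f e = -1}}"
      using proper_colouring_iff[OF assms] by (simp add: chi3_def)
    then show "(-2) ^ card E' * of_nat (chi3 (fst G, E')) =
        (\<Sum>f\<in>?C. if E' \<subseteq> {e \<in> ?E. edge_sign f e = -1} then (-2) ^ card E' else (0::complex))"
      using finC by (simp add: sum.If_cases Int_def)
  qed
  also have "\<dots> = (\<Sum>f\<in>?C. \<Sum>E'\<in>Pow ?E. if E' \<subseteq> {e \<in> ?E. edge_sign f e = -1} then (-2) ^ card E' else 0)"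
    by (rule sum.swap)
  also have "\<dots> = (\<Sum>f\<in>?C. \<Prod>e\<in>?E. edge_sign f e)"
  proof (rule sum.cong[OF refl])
    fix f
    have "(\<Sum>E'\<in>Pow ?E. if E' \<subseteq> {e \<in> ?E. edge_sign f e = -1} then (-2) ^ card E' else 0) =
        (\<Sum>E'\<in>Pow {e \<in> ?E. edge_sign f e = -1}. (-2) ^ card E' :: complex)"
      using finE by (intro sum.mono_neutral_cong_right) auto
    also have "\<dots> = (\<Prod>e\<in>?E. edge_sign f e)"
      using finE by (simp add: sum_Pow_minus_two prod_edge_sign)
    finally show "(\<Sum>E'\<in>Pow ?E. if E' \<subseteq> {e \<in> ?E. edge_sign f e = -1} then (-2) ^ card E' else 0) =
        (\<Prod>e\<in>?E. edge_sign f e)" .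
  qed
  finally show ?thesis
    by (simp add: phi_def colour_sum_def power_mult)
qed

lemma edge_sign_cong: "(\<And>x. x \<in> e \<Longrightarrow> f x = g x) \<Longrightarrow> edge_sign f e = edge_sign g e"
  by (simp add: edge_sign_def)

lemma graph_function_phi: "graph_function phi"
  unfolding graph_function_def
proof (intro allI impI)
  fix G H assume G: "simple_graph G" and H: "simple_graph H" and "graph_iso G H"
  then obtain h where h: "bij_betw h (fst G) (fst H)" and edges: "snd H = (\<lambda>e. h ` e) ` snd G"
    unfolding graph_iso_def by auto
  have "inj_on (\<lambda>e. h ` e) (snd G)"
    using G bij_betw_imp_inj_on[OF h]
    by (intro inj_on_subset[OF inj_on_image_Pow]) (auto simp: simple_graph_def)
  then have prod_H: "(\<Prod>e\<in>snd H. edge_sign f e) = (\<Prod>e\<in>snd G. edge_sign (restrict (f \<circ> h) (fst G)) e)" for f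
    unfolding edges
    by (subst prod.reindex)
      (use G in \<open>auto intro!: prod.cong simp: edge_sign_def simple_graph_def subset_iff\<close>)
  have inv: "inv_into (fst G) h y \<in> fst G" "h (inv_into (fst G) h y) = y" if "y \<in> fst H" for y
    using that h by (auto simp: bij_betw_def inv_into_into f_inv_into_f)
  have hG: "h x \<in> fst H" "inv_into (fst G) h (h x) = x" if "x \<in> fst G" for x
    using that h by (auto simp: bij_betw_def)
  have "colour_sum H (\<lambda>_. 1) = colour_sum G (\<lambda>_. 1)"
    unfolding colour_sum_def
    by (rule sum.reindex_bij_witness[where
          i = "\<lambda>f. restrict (f \<circ> inv_into (fst G) h) (fst H)" and j = "\<lambda>f. restrict (f \<circ> h) (fst G)"])
      (auto simp: prod_H inv hG fun_eq_iff PiE_def extensional_def Pi_def)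
  then show "phi G = phi H"
    using G H bij_betw_same_card[OF h] by (simp add: phi_eq_colour_sum)
qed

text \<open>
  Colourings of a disjoint union are pairs of colourings, and no edge sees both parts.
\<close>

lemma phi_disjoint_union:
  assumes "simple_graph G1" "simple_graph G2" and disj: "fst G1 \<inter> fst G2 = {}"
  shows "phi (fst G1 \<union> fst G2, snd G1 \<union> snd G2) = phi G1 * phi G2"
proof -
  let ?V1 = "fst G1" and ?V2 = "fst G2"
  let ?G = "(?V1 \<union> ?V2, snd G1 \<union> snd G2)"
  have e1: "e \<subseteq> ?V1" "card e = 2" if "e \<in> snd G1" for e
    using that assms by (auto simp: simple_graph_def)
  have e2: "e \<subseteq> ?V2" "card e = 2" if "e \<in> snd G2" for e
    using that assms by (auto simp: simple_graph_def)
  have simple: "simple_graph ?G"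
    using assms by (auto simp: simple_graph_def)
  have disj_edges: "snd G1 \<inter> snd G2 = {}"
  proof (rule ccontr)
    assume "snd G1 \<inter> snd G2 \<noteq> {}"
    then obtain e where "e \<in> snd G1" "e \<in> snd G2" by auto
    then have "e \<subseteq> ?V1 \<inter> ?V2" "card e = 2" using e1 e2 by auto
    then show False using disj by auto
  qed
  have prod1: "(\<Prod>e\<in>snd G1. edge_sign (restrict f ?V1) e) = (\<Prod>e\<in>snd G1. edge_sign f e)" for f
    using e1 by (intro prod.cong edge_sign_cong) auto
  have prod2: "(\<Prod>e\<in>snd G2. edge_sign (restrict f ?V2) e) = (\<Prod>e\<in>snd G2. edge_sign f e)" for f
    using e2 by (intro prod.cong edge_sign_cong) auto
  have "colour_sum G1 (\<lambda>_. 1) * colour_sum G2 (\<lambda>_. 1) =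
      (\<Sum>(f, g)\<in>colourings ?V1 \<times> colourings ?V2.
        (\<Prod>e\<in>snd G1. edge_sign f e) * (\<Prod>e\<in>snd G2. edge_sign g e))"
    by (simp add: colour_sum_def sum_product sum.cartesian_product)
  also have "\<dots> = colour_sum ?G (\<lambda>_. 1)"
    unfolding colour_sum_def
  proof (rule sum.reindex_bij_witness[where
        i = "\<lambda>h. (restrict h ?V1, restrict h ?V2)" and j = "\<lambda>(f, g) x. if x \<in> ?V1 then f x else g x"])
    fix fg assume "fg \<in> colourings ?V1 \<times> colourings ?V2"
    then obtain f g where fg: "fg = (f, g)" "f \<in> colourings ?V1" "g \<in> colourings ?V2" by auto
    define h where "h = (\<lambda>x. if x \<in> ?V1 then f x else g x)"
    have restr: "restrict h ?V1 = f" "restrict h ?V2 = g"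
      using fg disj by (auto simp: h_def fun_eq_iff PiE_def extensional_def)
    have h: "h \<in> colourings (?V1 \<union> ?V2)"
      using fg by (auto simp: h_def PiE_def extensional_def Pi_def)
    have "(\<Prod>e\<in>snd G1 \<union> snd G2. edge_sign h e) =
        (\<Prod>e\<in>snd G1. edge_sign f e) * (\<Prod>e\<in>snd G2. edge_sign g e)"
      using prod1[of h] prod2[of h] disj_edges assms
      by (simp add: prod.union_disjoint simple_graph_finite_edges restr)
    with restr h show "(restrict ((\<lambda>(f, g) x. if x \<in> ?V1 then f x else g x) fg) ?V1,
          restrict ((\<lambda>(f, g) x. if x \<in> ?V1 then f x else g x) fg) ?V2) = fg"
      and "(\<lambda>(f, g) x. if x \<in> ?V1 then f x else g x) fg \<in> colourings (fst ?G)"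
      and "(\<Prod>e\<in>snd ?G. edge_sign ((\<lambda>(f, g) x. if x \<in> ?V1 then f x else g x) fg) e) * 1 =
        (case fg of (f, g) \<Rightarrow> (\<Prod>e\<in>snd G1. edge_sign f e) * (\<Prod>e\<in>snd G2. edge_sign g e))"
      by (simp_all add: fg(1) h_def)
  next
    fix h assume "h \<in> colourings (fst ?G)"
    then show "(\<lambda>(f, g) x. if x \<in> ?V1 then f x else g x) (restrict h ?V1, restrict h ?V2) = h"
      and "(restrict h ?V1, restrict h ?V2) \<in> colourings ?V1 \<times> colourings ?V2"
      by (auto simp: fun_eq_iff PiE_def extensional_def Pi_def)
  qed
  finally show ?thesis
    using assms simple disj by (simp add: phi_eq_colour_sum card_Un_disjoint simple_graph_def power_add)
qed

section \<open>Adding vertices\<close>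

definition add_vertex :: "nat \<Rightarrow> nat set \<Rightarrow> graph \<Rightarrow> graph" where
  "add_vertex u a G = (insert u (fst G), snd G \<union> star u a)"

lemma simple_graph_add_vertex:
  assumes "simple_graph G" "u \<notin> fst G" "a \<subseteq> fst G"
  shows "simple_graph (add_vertex u a G)"
  using assms by (auto simp: simple_graph_def add_vertex_def star_def card_insert_if)

text \<open>
  The factor contributed by the edges from a vertex of colour \<open>c\<close> to its neighbourhood \<open>a\<close>.
\<close>

definition nbr_sign :: "(nat \<Rightarrow> nat) \<Rightarrow> nat set \<Rightarrow> nat \<Rightarrow> complex" where
  "nbr_sign f a c = (\<Prod>x\<in>a. colour_sign c (f x))"

lemma nbr_sign_empty [simp]: "nbr_sign f {} c = 1"
  by (simp add: nbr_sign_def)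

lemma nbr_sign_insert:
  "finite a \<Longrightarrow> u \<notin> a \<Longrightarrow> nbr_sign f (insert u a) c = colour_sign c (f u) * nbr_sign f a c"
  by (simp add: nbr_sign_def)

lemma colour_sign_commute: "colour_sign c d = colour_sign d c"
  by (simp add: colour_sign_def)

lemma nbr_sign_fun_upd: "u \<notin> a \<Longrightarrow> nbr_sign (f(u := d)) a c = nbr_sign f a c"
  unfolding nbr_sign_def by (rule prod.cong) auto

text \<open>
  Summing over the colour of the new vertex first leaves a colouring sum over the old graph, so that
  vertices can be added one after another.
\<close>

lemma colour_sum_add_vertex:
  assumes G: "simple_graph G" and u: "u \<notin> fst G" and a: "a \<subseteq> fst G"
  shows "colour_sum (add_vertex u a G) F =
    colour_sum G (\<lambda>f. \<Sum>c\<in>{1, 2, 3}. nbr_sign f a c * F (f(u := c)))"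
proof -
  have e: "u \<notin> e" if "e \<in> snd G" for e
    using that G u by (auto simp: simple_graph_def)
  have "finite a" using G a by (auto simp: simple_graph_def intro: finite_subset)
  have prod: "(\<Prod>e\<in>snd G \<union> star u a. edge_sign (f(u := c)) e) =
      (\<Prod>e\<in>snd G. edge_sign f e) * nbr_sign f a c" for f c
  proof -
    have "(\<Prod>e\<in>snd G. edge_sign (f(u := c)) e) = (\<Prod>e\<in>snd G. edge_sign f e)"
      using e by (intro prod.cong edge_sign_cong) auto
    moreover have "(\<Prod>e\<in>star u a. edge_sign (f(u := c)) e) = nbr_sign f a c"
    proof -
      have "inj_on (\<lambda>x. {u, x}) a"
        by (auto simp: inj_on_def doubleton_eq_iff)
      then have "(\<Prod>e\<in>star u a. edge_sign (f(u := c)) e) = (\<Prod>x\<in>a. edge_sign (f(u := c)) {u, x})"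
        unfolding star_def by (simp add: prod.reindex)
      also have "\<dots> = nbr_sign f a c"
        unfolding nbr_sign_def using u a
        by (intro prod.cong) (auto simp: edge_sign_pair)
      finally show ?thesis .
    qed
    moreover have "snd G \<inter> star u a = {}"
      using e by (auto simp: star_def)
    ultimately show ?thesis
      using G \<open>finite a\<close> by (simp add: prod.union_disjoint simple_graph_finite_edges star_def)
  qed
  have "colour_sum (add_vertex u a G) F =
      (\<Sum>(c, f)\<in>{1, 2, 3} \<times> colourings (fst G).
        (\<Prod>e\<in>snd G. edge_sign f e) * (nbr_sign f a c * F (f(u := c))))"
    unfolding colour_sum_def add_vertex_def fst_conv snd_conv PiE_insert_eq
    by (subst sum.reindex[OF inj_combinator[OF u]])
      (auto simp: prod mult.assoc intro!: sum.cong)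
  also have "\<dots> = (\<Sum>c\<in>{1, 2, 3}. \<Sum>f\<in>colourings (fst G).
        (\<Prod>e\<in>snd G. edge_sign f e) * (nbr_sign f a c * F (f(u := c))))"
    by (simp only: sum.cartesian_product)
  also have "\<dots> = colour_sum G (\<lambda>f. \<Sum>c\<in>{1, 2, 3}. nbr_sign f a c * F (f(u := c)))"
    unfolding colour_sum_def sum_distrib_left by (rule sum.swap)
  finally show ?thesis .
qed

section \<open>Characters and the local identities\<close>

text \<open>
  Identify the colours with the three nontrivial elements of the Klein four-group, in which each
  is the product of the other two.  The condition describes the restrictions of its characters.
\<close>

definition colour_character :: "(nat \<Rightarrow> complex) \<Rightarrow> bool" where
  "colour_character s \<longleftrightarrow> s 1 \<in> {1, -1} \<and> s 2 \<in> {1, -1} \<and> s 3 = s 1 * s 2"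

text \<open>
  For fixed \<open>d\<close> the function \<open>\<lambda>c. colour_sign c d\<close> is itself a character, namely the nontrivial one
  that is trivial at \<open>d\<close>, and characters are closed under products.
\<close>

lemma colour_character_mult_colour_sign:
  assumes "colour_character s" "d \<in> {1, 2, 3}"
  shows "colour_character (\<lambda>c. colour_sign c d * s c)"
proof -
  have s: "s 3 = s 1 * s 2" "s 1 \<in> {1, -1}" "s 2 \<in> {1, -1}"
    using assms(1) by (simp_all add: colour_character_def)
  show ?thesis
    using s(2,3) assms(2) unfolding colour_character_def
    by (elim insertE emptyE) (simp_all add: s(1) colour_sign_def)
qed

lemma colour_character_nbr_sign:
  assumes "finite a" "\<And>x. x \<in> a \<Longrightarrow> f x \<in> {1, 2, 3}"
  shows "colour_character (nbr_sign f a)"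
  using assms
proof (induction a)
  case empty
  then show ?case by (simp add: colour_character_def)
next
  case (insert x a)
  have "nbr_sign f (insert x a) = (\<lambda>c. colour_sign c (f x) * nbr_sign f a c)"
    using insert.hyps by (simp add: nbr_sign_insert fun_eq_iff)
  then show ?case
    using colour_character_mult_colour_sign insert by simp
qed

text \<open>
  The common vertices contribute squares of signs.
\<close>

lemma nbr_sign_sym_diff:
  assumes "finite a" "finite b"
  shows "nbr_sign f (sym_diff a b) c = nbr_sign f a c * nbr_sign f b c"
proof -
  have sq: "nbr_sign f (a \<inter> b) c * nbr_sign f (a \<inter> b) c = 1"
    unfolding nbr_sign_def prod.distrib[symmetric]
    by (rule prod.neutral) (auto simp: colour_sign_def)
  have "nbr_sign f a c = nbr_sign f (a - b) c * nbr_sign f (a \<inter> b) c"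
    unfolding nbr_sign_def using assms
    by (subst prod.union_disjoint[symmetric]) (auto intro!: prod.cong)
  moreover have "nbr_sign f b c = nbr_sign f (b - a) c * nbr_sign f (a \<inter> b) c"
    unfolding nbr_sign_def using assms
    by (subst prod.union_disjoint[symmetric]) (auto intro!: prod.cong)
  moreover have "nbr_sign f (sym_diff a b) c = nbr_sign f (a - b) c * nbr_sign f (b - a) c"
    unfolding nbr_sign_def using assms
    by (intro prod.union_disjoint) auto
  ultimately show ?thesis
    using sq by (simp add: mult_ac)
qed

text \<open>
  The sum over the colours of two new vertices, whose edges to the old graph contribute \<open>s\<close> and
  \<open>t\<close>; the flag says whether the new vertices are adjacent.
\<close>

definition kernel2 :: "bool \<Rightarrow> (nat \<Rightarrow> complex) \<Rightarrow> (nat \<Rightarrow> complex) \<Rightarrow> complex" where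
  "kernel2 i s t = (\<Sum>c\<in>{1, 2, 3}. \<Sum>d\<in>{1, 2, 3}. s c * t d * (if i then colour_sign c d else 1))"

text \<open>
  The analogue for three new vertices; the flags \<open>i\<close>, \<open>j\<close>, \<open>k\<close> stand for the edges joining the first
  to the second, the second to the third, and the first to the third.
\<close>

definition kernel3 :: "bool \<Rightarrow> bool \<Rightarrow> bool \<Rightarrow>
    (nat \<Rightarrow> complex) \<Rightarrow> (nat \<Rightarrow> complex) \<Rightarrow> (nat \<Rightarrow> complex) \<Rightarrow> complex" where
  "kernel3 i j k r s t = (\<Sum>c\<in>{1, 2, 3}. \<Sum>d\<in>{1, 2, 3}. \<Sum>e\<in>{1, 2, 3}. r c * s d * t e *
     (if i then colour_sign c d else 1) * (if j then colour_sign d e else 1) *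
     (if k then colour_sign c e else 1))"

text \<open>
  Both sides are \<open>-2\<close> times a sum over pairs of different colours \<open>c\<close>, \<open>d\<close>.  For such pairs
  \<open>t c * t d = t e\<close>, where \<open>e\<close> is the third colour, so replacing \<open>d\<close> by \<open>e\<close> exchanges the two sides.
\<close>

lemma kernel2_4T:
  assumes "colour_character t"
  shows "kernel2 True s t - kernel2 False s t =
    kernel2 True (\<lambda>c. s c * t c) t - kernel2 False (\<lambda>c. s c * t c) t"
proof -
  have t: "t 3 = t 1 * t 2" "t 1 \<in> {1, -1}" "t 2 \<in> {1, -1}"
    using assms by (auto simp: colour_character_def)
  show ?thesis
    using t(2,3) unfolding kernel2_def
    by (elim insertE emptyE) (simp_all add: t(1) colour_sign_def algebra_simps)
qed

text \<open>
  The alternating sum on the left kills all terms in which the middle colour equals one of the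
  outer colours, and gives weight \<open>4\<close> to the others.  Those with equal outer colours make up the
  off-diagonal part of the first sum on the right, and those with three different colours make up
  that of the second, again because the middle sign is the product of the other two values of \<open>s\<close>.  The
  diagonal parts on the right cancel.
\<close>

lemma kernel3_6T:
  assumes "colour_character s"
  shows "kernel3 True True k r s t - kernel3 False True k r s t - kernel3 True False k r s t
      + kernel3 False False k r s t =
    4 * kernel2 False s (\<lambda>c. r c * s c * t c) - 4 * kernel2 (\<not> k) (\<lambda>c. r c * s c) (\<lambda>c. s c * t c)"
proof -
  have s: "s 3 = s 1 * s 2" "s 1 \<in> {1, -1}" "s 2 \<in> {1, -1}"
    using assms by (auto simp: colour_character_def)
  show ?thesis
    using s(2,3) unfolding kernel2_def kernel3_def
    by (cases k; elim insertE emptyE) (simp_all add: s(1) colour_sign_def algebra_simps)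
qed

section \<open>The graph relations\<close>

lemma phi_add_vertex:
  assumes "simple_graph G" "u \<notin> fst G" "a \<subseteq> fst G"
  shows "phi (add_vertex u a G) =
    colour_sum G (\<lambda>f. \<Sum>c\<in>{1, 2, 3}. nbr_sign f a c) / 8 ^ (card (fst G) + 1)"
proof -
  have "card (fst (add_vertex u a G)) = card (fst G) + 1"
    using assms by (simp add: add_vertex_def simple_graph_def)
  then show ?thesis
    unfolding phi_eq_colour_sum[OF simple_graph_add_vertex[OF assms]] colour_sum_add_vertex[OF assms]
    by simp
qed

lemma star_Un_if:
  "star v (a \<union> (if i then {u} else {})) = star v a \<union> (if i then {{u, v}} else {})"
  by (simp add: star_def insert_commute)

lemma add2_eq_add_vertex:
  "add2 u v H a b i = add_vertex v (b \<union> (if i then {u} else {})) (add_vertex u a H)"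
  unfolding add2_def add_vertex_def star_Un_if by (simp add: Un_assoc insert_commute)

lemma add3_eq_add_vertex:
  "add3 A B C H x y z i j k =
    add_vertex C (z \<union> (if j then {B} else {}) \<union> (if k then {A} else {}))
      (add_vertex B (y \<union> (if i then {A} else {})) (add_vertex A x H))"
proof -
  have "E \<union> X \<union> Y \<union> Z \<union> I \<union> J \<union> K = E \<union> X \<union> (Y \<union> I) \<union> (Z \<union> J \<union> K)" for E X Y Z I J K :: "nat set set"
    by (simp only: Un_ac)
  then show ?thesis
    unfolding add3_def add_vertex_def star_Un_if by (simp add: insert_commute)
qed

lemma phi_add2:
  assumes H: "simple_graph H" and ab: "a \<subseteq> fst H" "b \<subseteq> fst H"
    and uv: "u \<notin> fst H" "v \<notin> fst H" "u \<noteq> v"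
  shows "phi (add2 u v H a b i) =
    colour_sum H (\<lambda>f. kernel2 i (nbr_sign f a) (nbr_sign f b)) / 8 ^ (card (fst H) + 2)"
proof -
  let ?b = "b \<union> (if i then {u} else {})"
  have fin: "finite b" and ub: "u \<notin> b"
    using H ab uv by (auto simp: simple_graph_def intro: finite_subset)
  have H1: "simple_graph (add_vertex u a H)" "v \<notin> fst (add_vertex u a H)"
    "?b \<subseteq> fst (add_vertex u a H)" "card (fst (add_vertex u a H)) = card (fst H) + 1"
    using H ab uv by (auto simp: simple_graph_add_vertex) (auto simp: add_vertex_def simple_graph_def)
  have b: "nbr_sign (f(u := c)) ?b d = nbr_sign f b d * (if i then colour_sign c d else 1)" for f c d
    using fin ub by (auto simp: nbr_sign_insert nbr_sign_fun_upd colour_sign_commute)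
  have kernel: "(\<Sum>c\<in>{1, 2, 3}. nbr_sign f a c * (\<Sum>d\<in>{1, 2, 3}. nbr_sign (f(u := c)) ?b d)) =
      kernel2 i (nbr_sign f a) (nbr_sign f b)" for f
    unfolding b kernel2_def sum_distrib_left by (simp only: mult.assoc)
  show ?thesis
    unfolding add2_eq_add_vertex phi_add_vertex[OF H1(1-3)]
      colour_sum_add_vertex[OF H uv(1) ab(1)] kernel H1(4)
    by (simp add: add.assoc)
qed

lemma phi_add3:
  assumes H: "simple_graph H" and xyz: "x \<subseteq> fst H" "y \<subseteq> fst H" "z \<subseteq> fst H"
    and ABC: "A \<notin> fst H" "B \<notin> fst H" "C \<notin> fst H" "A \<noteq> B" "B \<noteq> C" "A \<noteq> C"
  shows "phi (add3 A B C H x y z i j k) =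
    colour_sum H (\<lambda>f. kernel3 i j k (nbr_sign f x) (nbr_sign f y) (nbr_sign f z)) / 8 ^ (card (fst H) + 3)"
proof -
  let ?y = "y \<union> (if i then {A} else {})"
  let ?z = "z \<union> (if j then {B} else {}) \<union> (if k then {A} else {})"
  let ?H1 = "add_vertex A x H"
  let ?H2 = "add_vertex B ?y ?H1"
  have fin: "finite y" "finite z" and fresh: "A \<notin> y" "A \<notin> z" "B \<notin> z"
    using H xyz ABC by (auto simp: simple_graph_def intro: finite_subset)
  have H1: "simple_graph ?H1" "B \<notin> fst ?H1" "?y \<subseteq> fst ?H1"
    using H xyz ABC by (auto simp: simple_graph_add_vertex) (auto simp: add_vertex_def)
  have H2: "simple_graph ?H2" "C \<notin> fst ?H2" "?z \<subseteq> fst ?H2" "card (fst ?H2) = card (fst H) + 2"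
    using H xyz ABC H1 by (auto simp: simple_graph_add_vertex)
      (auto simp: add_vertex_def simple_graph_def)
  have y: "nbr_sign (f(A := c)) ?y d = nbr_sign f y d * (if i then colour_sign c d else 1)" for f c d
    using fin fresh by (auto simp: nbr_sign_insert nbr_sign_fun_upd colour_sign_commute)
  have z: "nbr_sign (f(A := c, B := d)) ?z e = nbr_sign f z e *
      ((if j then colour_sign d e else 1) * (if k then colour_sign c e else 1))" for f c d e
    using fin fresh ABC by (auto simp: nbr_sign_insert nbr_sign_fun_upd colour_sign_commute)
  have kernel: "(\<Sum>c\<in>{1, 2, 3}. nbr_sign f x c * (\<Sum>d\<in>{1, 2, 3}. nbr_sign (f(A := c)) ?y d *
        (\<Sum>e\<in>{1, 2, 3}. nbr_sign (f(A := c, B := d)) ?z e))) =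
      kernel3 i j k (nbr_sign f x) (nbr_sign f y) (nbr_sign f z)" for f
    unfolding y z kernel3_def sum_distrib_left by (simp only: mult_ac)
  show ?thesis
    unfolding add3_eq_add_vertex phi_add_vertex[OF H2(1-3)] colour_sum_add_vertex[OF H1]
      colour_sum_add_vertex[OF H ABC(1) xyz(1)] kernel H2(4)
    by (simp add: power_add)
qed

lemma colour_sum_diff: "colour_sum H F - colour_sum H G = colour_sum H (\<lambda>f. F f - G f)"
  by (simp only: colour_sum_def right_diff_distrib sum_subtractf)

lemma colour_sum_add: "colour_sum H F + colour_sum H G = colour_sum H (\<lambda>f. F f + G f)"
  by (simp only: colour_sum_def distrib_left sum.distrib)

lemma colour_sum_scale: "c * colour_sum H F = colour_sum H (\<lambda>f. c * F f)"
  by (simp only: colour_sum_def sum_distrib_left mult.left_commute)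

text \<open>
  An identity between local sums has to be known for characters only.
\<close>

lemma colour_sum_cong_character:
  assumes "\<And>f. (\<And>a. a \<subseteq> fst H \<Longrightarrow> finite a \<Longrightarrow> colour_character (nbr_sign f a)) \<Longrightarrow> F f = F' f"
  shows "colour_sum H F = colour_sum H F'"
proof -
  have "F f = F' f" if "f \<in> colourings (fst H)" for f
  proof (rule assms, rule colour_character_nbr_sign)
    fix a x assume "a \<subseteq> fst H" "x \<in> a"
    then show "f x \<in> {1, 2, 3}"
      using that PiE_mem by (metis subsetD)
  qed
  then show ?thesis
    by (simp add: colour_sum_def)
qed

theorem four_invariant_phi: "four_invariant phi"
  unfolding four_invariant_def
proof (intro conjI allI impI)
  show "graph_function phi" by (rule graph_function_phi)
next
  fix H a b u v
  assume "simple_graph H \<and> a \<subseteq> fst H \<and> b \<subseteq> fst H \<and> u \<notin> fst H \<and> v \<notin> fst H \<and> u \<noteq> v"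
  then have H: "simple_graph H" and ab: "a \<subseteq> fst H" "b \<subseteq> fst H"
    and uv: "u \<notin> fst H" "v \<notin> fst H" "u \<noteq> v" by auto
  have fin: "finite a" "finite b" and sd: "sym_diff a b \<subseteq> fst H"
    using H ab by (auto simp: simple_graph_def intro: finite_subset)
  have sgn: "nbr_sign f (sym_diff a b) = (\<lambda>c. nbr_sign f a c * nbr_sign f b c)" for f
    using fin by (simp add: nbr_sign_sym_diff fun_eq_iff)
  have "colour_sum H (\<lambda>f. kernel2 True (nbr_sign f a) (nbr_sign f b) - kernel2 False (nbr_sign f a) (nbr_sign f b)) =
      colour_sum H (\<lambda>f. kernel2 True (nbr_sign f (sym_diff a b)) (nbr_sign f b)
        - kernel2 False (nbr_sign f (sym_diff a b)) (nbr_sign f b))"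
    unfolding sgn
    using ab fin by (intro colour_sum_cong_character kernel2_4T) auto
  then show "phi (add2 u v H a b True) - phi (add2 u v H a b False) =
      phi (add2 u v H (sym_diff a b) b True) - phi (add2 u v H (sym_diff a b) b False)"
    by (simp only: phi_add2[OF H ab uv] phi_add2[OF H sd ab(2) uv] diff_divide_distrib[symmetric] colour_sum_diff)
qed

text \<open>
  The names of the new vertices on the right are arbitrary and may differ between the two
  graphs there, since chord diagrams give them in different orders.
\<close>

theorem phi_6T:
  assumes H: "simple_graph H" and xyz: "x \<subseteq> fst H" "y \<subseteq> fst H" "z \<subseteq> fst H"
    and ABC: "A \<notin> fst H" "B \<notin> fst H" "C \<notin> fst H" "A \<noteq> B" "B \<noteq> C" "A \<noteq> C"
    and uv: "u \<notin> fst H" "v \<notin> fst H" "u \<noteq> v"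
    and uv': "u' \<notin> fst H" "v' \<notin> fst H" "u' \<noteq> v'"
  shows "phi (add3 A B C H x y z True True k) - phi (add3 A B C H x y z False True k)
      - phi (add3 A B C H x y z True False k) + phi (add3 A B C H x y z False False k) =
    1/2 * phi (add2 u v H y (sym_diff (sym_diff x y) z) False)
      - 1/2 * phi (add2 u' v' H (sym_diff x y) (sym_diff y z) (\<not> k))"
proof -
  have fin: "finite x" "finite y" "finite z"
    and sd: "sym_diff (sym_diff x y) z \<subseteq> fst H" "sym_diff x y \<subseteq> fst H" "sym_diff y z \<subseteq> fst H"
    using H xyz by (auto simp: simple_graph_def intro: finite_subset)
  have sgn: "nbr_sign f (sym_diff x y) = (\<lambda>c. nbr_sign f x c * nbr_sign f y c)"
    "nbr_sign f (sym_diff y z) = (\<lambda>c. nbr_sign f y c * nbr_sign f z c)"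
    "nbr_sign f (sym_diff (sym_diff x y) z) = (\<lambda>c. nbr_sign f x c * nbr_sign f y c * nbr_sign f z c)" for f
  proof -
    have "finite (sym_diff x y)" using fin by simp
    with fin show "nbr_sign f (sym_diff x y) = (\<lambda>c. nbr_sign f x c * nbr_sign f y c)"
      "nbr_sign f (sym_diff y z) = (\<lambda>c. nbr_sign f y c * nbr_sign f z c)"
      "nbr_sign f (sym_diff (sym_diff x y) z) = (\<lambda>c. nbr_sign f x c * nbr_sign f y c * nbr_sign f z c)"
      by (simp_all only: nbr_sign_sym_diff fun_eq_iff simp_thms)
  qed
  let ?S3 = "\<lambda>i j. colour_sum H (\<lambda>f. kernel3 i j k (nbr_sign f x) (nbr_sign f y) (nbr_sign f z))"
  let ?R1 = "colour_sum H (\<lambda>f. kernel2 False (nbr_sign f y) (nbr_sign f (sym_diff (sym_diff x y) z)))"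
  let ?R2 = "colour_sum H (\<lambda>f. kernel2 (\<not> k) (nbr_sign f (sym_diff x y)) (nbr_sign f (sym_diff y z)))"
  have sums: "?S3 True True - ?S3 False True - ?S3 True False + ?S3 False False = 4 * ?R1 - 4 * ?R2"
    unfolding colour_sum_diff colour_sum_add colour_sum_scale sgn
    using xyz fin by (intro colour_sum_cong_character kernel3_6T) auto
  (* The graphs on the left have one vertex more than those on the right, which turns 4 into 4/8. *)
  show ?thesis
    unfolding phi_add3[OF H xyz ABC] phi_add2[OF H xyz(2) sd(1) uv] phi_add2[OF H sd(2,3) uv']
      diff_divide_distrib[symmetric] add_divide_distrib[symmetric] sums
    by (simp add: power_add diff_divide_distrib)
qed

text \<open>
  Summed over its three colours, a leaf contributes \<open>1 - 1 - 1\<close>, whatever the colour of its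
  neighbour; divided by \<open>8\<close> this is \<open>3/8 - 1/2\<close>.
\<close>

theorem phi_leaf:
  assumes G: "simple_graph G" and v: "v \<notin> fst G" and x: "x \<in> fst G"
  shows "phi (add_vertex v {x} G) = (3/8 - 1/2) * phi G"
proof -
  have sum: "(\<Sum>c\<in>{1, 2, 3}. nbr_sign f {x} c) = -1" if "f x \<in> {1, 2, 3}" for f
    using that by (auto simp: nbr_sign_insert colour_sign_def)
  have "colour_sum G (\<lambda>f. \<Sum>c\<in>{1, 2, 3}. nbr_sign f {x} c) = colour_sum G (\<lambda>_. -1)"
    unfolding colour_sum_def by (intro sum.cong refl arg_cong2[where f = "(*)"] sum) (use x in auto)
  also have "\<dots> = - colour_sum G (\<lambda>_. 1)"
    by (simp add: colour_sum_def sum_negf)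
  finally show ?thesis
    using x by (subst phi_add_vertex[OF G v]) (auto simp: phi_eq_colour_sum[OF G])
qed

lemma phi_isolated_vertex:
  assumes "simple_graph G" "v \<notin> fst G"
  shows "phi (add_vertex v {} G) = 3/8 * phi G"
proof -
  have "colour_sum G (\<lambda>f. \<Sum>c\<in>{1, 2, 3}. nbr_sign f {} c) = 3 * colour_sum G (\<lambda>_. 1)"
    by (simp add: colour_sum_scale)
  then show ?thesis
    using assms by (subst phi_add_vertex) (simp_all add: phi_eq_colour_sum)
qed

lemma phi_empty_graph: "phi ({}, {}) = 1"
  by (simp add: phi_def chi3_def)

lemma degree_one_vertex:
  assumes G: "simple_graph G" "v \<in> fst G" "card {e \<in> snd G. v \<in> e} = 1"
  obtains x where "x \<in> fst G - {v}" "G = add_vertex v {x} (fst G - {v}, {e \<in> snd G. v \<notin> e})"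
proof -
  obtain e where e: "{e \<in> snd G. v \<in> e} = {e}"
    using G(3) by (auto simp: card_1_singleton_iff)
  then have eG: "e \<in> snd G" "v \<in> e" by auto
  obtain a b where "e = {a, b}" "a \<noteq> b" "a \<in> fst G" "b \<in> fst G"
    using simple_graph_edge[OF G(1) eG(1)] .
  with eG(2) obtain x where x: "e = {v, x}" "x \<in> fst G - {v}"
    by (cases "v = a") auto
  have "snd G = {e \<in> snd G. v \<notin> e} \<union> {e \<in> snd G. v \<in> e}" by auto
  then have "snd G = {e \<in> snd G. v \<notin> e} \<union> {{v, x}}"
    using e x(1) by simp
  then have "G = add_vertex v {x} (fst G - {v}, {e \<in> snd G. v \<notin> e})"
    using G(2) by (simp add: add_vertex_def star_def insert_absorb prod_eq_iff)
  with x that show ?thesis by blast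
qed

theorem graph_CV_relations_phi: "graph_CV_relations (3/8) phi"
  unfolding graph_CV_relations_def
proof (intro conjI allI impI)
  show "graph_function phi" by (rule graph_function_phi)
next
  fix v
  show "phi ({v}, {}) = 3/8"
    using phi_isolated_vertex[of "({}, {})" v] phi_empty_graph
    by (simp add: add_vertex_def star_def simple_graph_def)
next
  fix G1 G2 :: graph
  assume "simple_graph G1 \<and> simple_graph G2 \<and> fst G1 \<inter> fst G2 = {}"
  then show "phi (fst G1 \<union> fst G2, snd G1 \<union> snd G2) = phi G1 * phi G2"
    by (intro phi_disjoint_union) auto
next
  fix G v
  assume asm: "simple_graph G \<and> v \<in> fst G \<and> card {e \<in> snd G. v \<in> e} = 1"
  let ?G' = "(fst G - {v}, {e \<in> snd G. v \<notin> e})"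
  obtain x where x: "x \<in> fst G - {v}" "G = add_vertex v {x} ?G'"
    using degree_one_vertex[of G v] asm by blast
  have "simple_graph ?G'"
    using asm unfolding simple_graph_def by auto
  then have "phi (add_vertex v {x} ?G') = (3/8 - 1/2) * phi ?G'"
    using x(1) by (intro phi_leaf) auto
  with x(2) show "phi G = (3/8 - 1/2) * phi ?G'" by simp
next
  show "graph_6T phi"
    unfolding graph_6T_def Let_def
  proof (intro allI impI)
    fix H x y z A B C
    assume "simple_graph H \<and> x \<subseteq> fst H \<and> y \<subseteq> fst H \<and> z \<subseteq> fst H \<and>
      A \<notin> fst H \<and> B \<notin> fst H \<and> C \<notin> fst H \<and> A \<noteq> B \<and> B \<noteq> C \<and> A \<noteq> C"
    then have "phi (add3 A B C H x y z True True k) - phi (add3 A B C H x y z False True k)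
        - phi (add3 A B C H x y z True False k) + phi (add3 A B C H x y z False False k) =
      1/2 * phi (add2 A B H y (sym_diff (sym_diff x y) z) False)
        - 1/2 * phi (add2 A B H (sym_diff x y) (sym_diff y z) (\<not> k))" for k
      by (intro phi_6T) simp_all
    from this[of False] this[of True]
    show "phi (add3 A B C H x y z True True False) - phi (add3 A B C H x y z False True False)
          - phi (add3 A B C H x y z True False False) + phi (add3 A B C H x y z False False False) =
        1/2 * phi (add2 A B H y (sym_diff (sym_diff x y) z) False)
          - 1/2 * phi (add2 A B H (sym_diff x y) (sym_diff y z) True) \<and>
        phi (add3 A B C H x y z True True True) - phi (add3 A B C H x y z False True True)
          - phi (add3 A B C H x y z True False True) + phi (add3 A B C H x y z False False True) =
        1/2 * phi (add2 A B H y (sym_diff (sym_diff x y) z) False)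
          - 1/2 * phi (add2 A B H (sym_diff x y) (sym_diff y z) False)"
      unfolding not_False_eq_True not_True_eq_False by (rule conjI)
  qed
qed

section \<open>Intersection graphs of words\<close>

lemma chord_diagram_iff: "chord_diagram D \<longleftrightarrow> (\<forall>a. count_list D a = 0 \<or> count_list D a = 2)"
  unfolding chord_diagram_def by (metis count_list_0_iff zero_neq_numeral)

lemma chord_diagram_add_chord:
  "chord_diagram (U @ [a] @ V @ [a] @ W) \<longleftrightarrow> chord_diagram (U @ V @ W) \<and> a \<notin> set (U @ V @ W)"
proof
  assume D: "chord_diagram (U @ [a] @ V @ [a] @ W)"
  then have a: "count_list U a = 0" "count_list V a = 0" "count_list W a = 0"
    unfolding chord_diagram_iff by (auto dest!: spec[of _ a])
  have "count_list (U @ V @ W) x = 0 \<or> count_list (U @ V @ W) x = 2" for x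
    using D[unfolded chord_diagram_iff, rule_format, of x] a by (cases "x = a") auto
  then show "chord_diagram (U @ V @ W) \<and> a \<notin> set (U @ V @ W)"
    using a unfolding chord_diagram_iff by (auto simp: count_list_0_iff)
next
  assume D: "chord_diagram (U @ V @ W) \<and> a \<notin> set (U @ V @ W)"
  then have a: "count_list U a = 0" "count_list V a = 0" "count_list W a = 0"
    by (auto simp: count_list_0_iff)
  have "count_list (U @ [a] @ V @ [a] @ W) x = 0 \<or> count_list (U @ [a] @ V @ [a] @ W) x = 2" for x
    using D[THEN conjunct1, unfolded chord_diagram_iff, rule_format, of x] a by (cases "x = a") auto
  then show "chord_diagram (U @ [a] @ V @ [a] @ W)"
    unfolding chord_diagram_iff by blast
qed

lemma chords_intersect_commute: "chords_intersect D a b \<longleftrightarrow> chords_intersect D b a"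
  unfolding chords_intersect_def by (auto simp: disj_commute)

lemma chords_intersect_in_set:
  assumes "chords_intersect D a b"
  shows "a \<in> set D" "b \<in> set D"
proof -
  have "set (filter (\<lambda>x. x = a \<or> x = b) D) = {a, b}"
    using assms unfolding chords_intersect_def by (auto simp del: set_filter)
  then show "a \<in> set D" "b \<in> set D"
    by (metis filter_is_subset insertCI subsetD)+
qed

lemma not_chords_intersect_self:
  assumes "chord_diagram D"
  shows "\<not> chords_intersect D a a"
proof
  assume "chords_intersect D a a"
  then have "length (filter (\<lambda>x. a = x) D) = 4"
    unfolding chords_intersect_def by (auto simp: eq_commute)
  then have "count_list D a = 4"
    by (simp add: count_list_eq_length_filter)
  then show False
    using assms unfolding chord_diagram_iff by (auto dest!: spec[of _ a])
qed

lemma simple_graph_intersection_graph: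
  assumes "chord_diagram D"
  shows "simple_graph (intersection_graph D)"
  unfolding simple_graph_def
proof (intro conjI subsetI)
  show "finite (fst (intersection_graph D))" by (simp add: intersection_graph_def)
next
  fix e assume "e \<in> snd (intersection_graph D)"
  then obtain a b where e: "e = {a, b}" "chords_intersect D a b"
    by (auto simp: intersection_graph_def)
  then have "a \<noteq> b" "a \<in> set D" "b \<in> set D"
    using chords_intersect_in_set not_chords_intersect_self[OF assms] by blast+
  with e show "e \<in> {e. e \<subseteq> fst (intersection_graph D) \<and> card e = 2}"
    by (simp add: intersection_graph_def)
qed

lemma chords_intersect_rotate1: "chords_intersect (rotate1 D) a b \<longleftrightarrow> chords_intersect D a b"
proof (cases D)
  case Nil
  then show ?thesis by simp
next
  case (Cons x xs)
  have rot: "ys @ [y] \<in> {[a, b, a, b], [b, a, b, a]} \<longleftrightarrow> y # ys \<in> {[a, b, a, b], [b, a, b, a]}" for y ys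
    by (auto simp: append_eq_Cons_conv Cons_eq_append_conv)
  show ?thesis
    using rot[of "filter (\<lambda>x. x = a \<or> x = b) xs" x] unfolding Cons chords_intersect_def by simp
qed

lemma intersection_graph_rotate: "intersection_graph (rotate k D) = intersection_graph D"
proof -
  have "chords_intersect (rotate k D) a b \<longleftrightarrow> chords_intersect D a b" for a b
    by (induction k) (simp_all add: chords_intersect_rotate1)
  then show ?thesis
    by (simp add: intersection_graph_def)
qed

text \<open>
  In a chord diagram, the chords with exactly one end on the arc \<open>V\<close>.  Parity is used since it turns
  concatenation into symmetric difference.
\<close>

definition odd_letters :: "nat list \<Rightarrow> nat set" where
  "odd_letters V = {x. odd (count_list V x)}"

lemma odd_letters_subset: "odd_letters V \<subseteq> set V"
proof
  fix x assume "x \<in> odd_letters V"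
  then have "count_list V x \<noteq> 0" unfolding odd_letters_def by (auto intro: ccontr)
  then show "x \<in> set V" by (simp add: count_list_0_iff)
qed

lemma odd_letters_append: "odd_letters (V @ W) = sym_diff (odd_letters V) (odd_letters W)"
  by (auto simp: odd_letters_def)

lemma odd_letters_Nil [simp]: "odd_letters [] = {}"
  by (simp add: odd_letters_def)

lemma odd_letters_insert:
  assumes "c \<notin> set (V @ W)"
  shows "odd_letters (V @ [c] @ W) = odd_letters (V @ W) \<union> {c}"
  using assms by (auto simp: odd_letters_def count_list_0_iff)

lemma odd_letters_insert_twice: "odd_letters (U @ [c] @ V @ [c] @ W) = odd_letters (U @ V @ W)"
  by (auto simp: odd_letters_def)

lemma filter_letters_eq_replicate:
  "a \<notin> set V \<Longrightarrow> filter (\<lambda>x. x = a \<or> x = b) V = replicate (count_list V b) b"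
  by (induction V) auto

text \<open>
  Restricted to the letters \<open>a\<close> and \<open>b\<close>, the word is determined by how the two occurrences of \<open>b\<close>
  are distributed over the three parts cut off by \<open>a\<close>; the letters interlace iff exactly one
  occurrence is in the middle part.
\<close>

lemma chords_intersect_iff_odd:
  assumes D: "chord_diagram (U @ [a] @ V @ [a] @ W)"
  shows "chords_intersect (U @ [a] @ V @ [a] @ W) a b \<longleftrightarrow> b \<in> odd_letters V"
proof (cases "b = a")
  case True
  have "a \<notin> set V" using D unfolding chord_diagram_add_chord by simp
  then show ?thesis
    using True odd_letters_subset not_chords_intersect_self[OF D] by blast
next
  case False
  let ?u = "count_list U b" and ?v = "count_list V b" and ?w = "count_list W b"
  have "a \<notin> set U" "a \<notin> set V" "a \<notin> set W"
    using D unfolding chord_diagram_add_chord by simp_all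
  then have filter: "filter (\<lambda>x. x = a \<or> x = b) (U @ [a] @ V @ [a] @ W) =
      replicate ?u b @ [a] @ replicate ?v b @ [a] @ replicate ?w b"
    by (simp add: filter_letters_eq_replicate)
  have "?u + ?v + ?w = 0 \<or> ?u + ?v + ?w = 2"
    using D[unfolded chord_diagram_iff, rule_format, of b] False by (simp add: add.assoc)
  then have "(?u, ?v, ?w) \<in> {(0, 0, 0), (2, 0, 0), (0, 2, 0), (0, 0, 2), (1, 1, 0), (1, 0, 1), (0, 1, 1)}"
    unfolding insert_iff empty_iff prod.inject by presburger
  moreover have "replicate 2 b = [b, b]"
    by (simp add: numeral_2_eq_2)
  ultimately show ?thesis
    unfolding chords_intersect_def filter odd_letters_def using False
    by (elim insertE emptyE) simp_all
qed

text \<open>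
  With this, an intersection graph is built chord by chord, in any convenient order.
\<close>

lemma intersection_graph_add_chord:
  assumes D: "chord_diagram (U @ [a] @ V @ [a] @ W)"
  shows "intersection_graph (U @ [a] @ V @ [a] @ W) =
    add_vertex a (odd_letters V) (intersection_graph (U @ V @ W))" (is "intersection_graph ?D = _")
proof -
  have other: "chords_intersect ?D p q \<longleftrightarrow> chords_intersect (U @ V @ W) p q" if "p \<noteq> a" "q \<noteq> a" for p q
    using that by (simp add: chords_intersect_def)
  have old: "p \<noteq> a \<and> q \<noteq> a" if "chords_intersect (U @ V @ W) p q" for p q
    using chords_intersect_in_set[OF that] D unfolding chord_diagram_add_chord by auto
  have edges: "{{p, q} |p q. chords_intersect ?D p q} =
      {{p, q} |p q. chords_intersect (U @ V @ W) p q} \<union> star a (odd_letters V)"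
  proof (intro equalityI subsetI)
    fix e assume "e \<in> {{p, q} |p q. chords_intersect ?D p q}"
    then obtain p q where e: "e = {p, q}" "chords_intersect ?D p q" by blast
    consider "p = a" | "q = a" | "p \<noteq> a" "q \<noteq> a" by blast
    then show "e \<in> {{p, q} |p q. chords_intersect (U @ V @ W) p q} \<union> star a (odd_letters V)"
    proof cases
      case 1
      then have "q \<in> odd_letters V" using e(2) chords_intersect_iff_odd[OF D] by simp
      then show ?thesis using e(1) 1 by (simp add: star_def)
    next
      case 2
      then have "p \<in> odd_letters V"
        using e(2) chords_intersect_iff_odd[OF D] chords_intersect_commute by blast
      then show ?thesis using e(1) 2 by (simp add: star_def insert_commute)
    next
      case 3
      then show ?thesis using e other by blast
    qed
  next
    fix e assume "e \<in> {{p, q} |p q. chords_intersect (U @ V @ W) p q} \<union> star a (odd_letters V)"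
    then consider p q where "e = {p, q}" "chords_intersect (U @ V @ W) p q"
      | x where "e = {a, x}" "x \<in> odd_letters V"
      unfolding star_def by blast
    then show "e \<in> {{p, q} |p q. chords_intersect ?D p q}"
    proof cases
      case 1
      then show ?thesis using old other by blast
    next
      case 2
      then show ?thesis using chords_intersect_iff_odd[OF D] by blast
    qed
  qed
  then show ?thesis
    unfolding intersection_graph_def add_vertex_def by simp
qed

text \<open>
  Here the middle vertex is added last: in the diagrams of the 6T-relations, removing the chord \<open>a\<close>
  leaves the same diagram in all four terms.
\<close>

lemma add3_eq_add_middle_vertex:
  "add3 b a c H x y z i j k =
    add_vertex a (y \<union> (if i then {b} else {}) \<union> (if j then {c} else {}))
      (add_vertex b (x \<union> (if k then {c} else {})) (add_vertex c z H))"
proof -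
  have "E \<union> X \<union> Y \<union> Z \<union> I \<union> J \<union> K = E \<union> Z \<union> (X \<union> K) \<union> (Y \<union> I \<union> J)" for E X Y Z I J K :: "nat set set"
    by (simp only: Un_ac)
  then show ?thesis
    unfolding add3_def add_vertex_def star_Un_if by (simp add: insert_commute)
qed

text \<open>
  In the 6T-relations the ends of \<open>b\<close> and \<open>c\<close> next to the ends of \<open>a\<close> lie either both inside, both
  outside, or on different sides of the arc of \<open>a\<close>.  The flags record which of them lie inside.
\<close>

lemma intersection_graph_middle_chord:
  assumes D: "chord_diagram ([b] @ P @ [c] @ X)" and a: "a \<notin> set ([b] @ P @ [c] @ X)"
    and bc: "b \<noteq> c" "b \<notin> set P" "c \<notin> set P"
  shows "intersection_graph ((if i then [a, b] else [b, a]) @ P @ (if j then [c, a] else [a, c]) @ X) =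
    add_vertex a (odd_letters P \<union> (if i then {b} else {}) \<union> (if j then {c} else {}))
      (intersection_graph ([b] @ P @ [c] @ X))"
proof -
  let ?U = "if i then [] else [b]" and ?B = "if i then [b] else []"
    and ?C = "if j then [c] else []" and ?W = "if j then X else [c] @ X"
  have word: "(if i then [a, b] else [b, a]) @ P @ (if j then [c, a] else [a, c]) @ X =
      ?U @ [a] @ (?B @ P @ ?C) @ [a] @ ?W"
    by simp
  have rest: "?U @ (?B @ P @ ?C) @ ?W = [b] @ P @ [c] @ X"
    by simp
  have "chord_diagram (?U @ [a] @ (?B @ P @ ?C) @ [a] @ ?W)"
    unfolding chord_diagram_add_chord rest using D a by simp
  note graph = intersection_graph_add_chord[OF this, unfolded rest]
  have "odd_letters (?B @ P @ ?C) = odd_letters P \<union> (if i then {b} else {}) \<union> (if j then {c} else {})"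
    using bc odd_letters_insert[of b "[]" "P @ ?C"] odd_letters_insert[of c P "[]"] by auto
  with graph show ?thesis
    unfolding word by simp
qed

text \<open>
  The arcs cut off by the three chords translate the two chord relations into the graph relations
  without and with the edge between the outer vertices \<open>b\<close> and \<open>c\<close>.  The neighbourhoods on
  the right match because symmetric differences of \<open>odd_letters\<close> of adjacent arcs are \<open>odd_letters\<close> of
  their concatenations.
\<close>

theorem chord_6T_phi: "chord_6T (\<lambda>D. [:phi (intersection_graph D):])"
  unfolding chord_6T_def
proof (intro allI impI)
  fix P Q R S a b c
  assume asm: "chord_diagram (P @ Q @ R @ S) \<and> a \<notin> set (P @ Q @ R @ S) \<and> b \<notin> set (P @ Q @ R @ S) \<and>
    c \<notin> set (P @ Q @ R @ S) \<and> a \<noteq> b \<and> b \<noteq> c \<and> a \<noteq> c"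
  let ?H = "intersection_graph (P @ Q @ R @ S)" and ?y = "odd_letters P"
  let ?word = "\<lambda>X i j. (if i then [a, b] else [b, a]) @ P @ (if j then [c, a] else [a, c]) @ X"
  have fst_H: "fst ?H = set (P @ Q @ R @ S)"
    by (simp add: intersection_graph_def)
  have H: "simple_graph ?H"
    using asm simple_graph_intersection_graph by blast
  have fresh: "a \<notin> fst ?H" "b \<notin> fst ?H" "c \<notin> fst ?H" "b \<noteq> a" "a \<noteq> c" "b \<noteq> c"
    unfolding fst_H using asm by blast+
  have sub: "odd_letters V \<subseteq> fst ?H" if "set V \<subseteq> set (P @ Q @ R @ S)" for V
    using that odd_letters_subset[of V] unfolding fst_H by (rule order_trans[rotated])
  let ?X1 = "Q @ [c] @ R @ [b] @ S" and ?X2 = "Q @ [b] @ R @ [c] @ S"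
  have c1: "chord_diagram (P @ [c] @ Q @ [c] @ (R @ S))"
    by (rule iffD2[OF chord_diagram_add_chord]) (use asm in simp)
  have "chord_diagram ((P @ Q) @ [c] @ R @ [c] @ S)"
    by (rule iffD2[OF chord_diagram_add_chord]) (use asm in simp)
  then have c2: "chord_diagram (P @ Q @ [c] @ R @ [c] @ S)"
    by simp
  have c3: "chord_diagram (P @ [c] @ (Q @ R) @ [c] @ S)"
    by (rule iffD2[OF chord_diagram_add_chord]) (use asm in simp)
  have b1: "chord_diagram ([] @ [b] @ (P @ [c] @ Q @ [c] @ R) @ [b] @ S)"
    by (rule iffD2[OF chord_diagram_add_chord]) (use c1 asm in simp)
  have b2: "chord_diagram ([] @ [b] @ (P @ [c] @ Q) @ [b] @ (R @ [c] @ S))"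
    by (rule iffD2[OF chord_diagram_add_chord]) (use c3 asm in simp)
  have b3: "chord_diagram ([] @ [b] @ P @ [b] @ (Q @ [c] @ R @ [c] @ S))"
    by (rule iffD2[OF chord_diagram_add_chord]) (use c2 asm in simp)
  have bc1: "intersection_graph ([b] @ P @ [c] @ ?X1) =
      add_vertex b (odd_letters (P @ Q @ R)) (add_vertex c (odd_letters Q) ?H)"
    using intersection_graph_add_chord[OF b1] intersection_graph_add_chord[OF c1]
    by (simp add: odd_letters_insert_twice[of P c Q R, simplified])
  have bc2: "intersection_graph ([b] @ P @ [c] @ ?X2) =
      add_vertex b (odd_letters (P @ Q) \<union> {c}) (add_vertex c (odd_letters (Q @ R)) ?H)"
    using intersection_graph_add_chord[OF b2] intersection_graph_add_chord[OF c3] asm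
      odd_letters_insert[of c P Q] by simp
  have "intersection_graph ([b] @ P @ [b] @ Q @ [c] @ R @ [c] @ S) =
      add_vertex b (odd_letters P) (add_vertex c (odd_letters R) ?H)"
    using intersection_graph_add_chord[OF b3] intersection_graph_add_chord[of "P @ Q" c R S] c2 by simp
  also have "\<dots> = add2 b c ?H (odd_letters P) (odd_letters R) False"
    by (auto simp: add2_def add_vertex_def)
  finally have split: "intersection_graph ([b] @ P @ [b] @ Q @ [c] @ R @ [c] @ S) = \<dots>" .
  have one: "intersection_graph (?word ?X1 i j) =
      add3 b a c ?H (odd_letters (P @ Q @ R)) ?y (odd_letters Q) i j False" for i j
    unfolding add3_eq_add_middle_vertex
    using intersection_graph_middle_chord[of b P c ?X1 a i j] b1 bc1 asm by simp
  have two: "intersection_graph (?word ?X2 i j) =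
      add3 b a c ?H (odd_letters (P @ Q)) ?y (odd_letters (Q @ R)) i j True" for i j
    unfolding add3_eq_add_middle_vertex
    using intersection_graph_middle_chord[of b P c ?X2 a i j] b2 bc2 asm by simp
  have crossing: "intersection_graph ([b] @ P @ [c] @ ?X2) =
      add2 c b ?H (odd_letters (Q @ R)) (odd_letters (P @ Q)) True"
    unfolding bc2 add2_eq_add_vertex by simp
  have nested: "intersection_graph ([b] @ P @ [c] @ ?X1) =
      add2 c b ?H (odd_letters Q) (odd_letters (P @ Q @ R)) False"
    unfolding bc1 add2_eq_add_vertex by simp
  have sd1: "sym_diff (odd_letters (P @ Q @ R)) ?y = odd_letters (Q @ R)"
    "sym_diff ?y (odd_letters Q) = odd_letters (P @ Q)"
    "sym_diff (odd_letters (Q @ R)) (odd_letters Q) = odd_letters R"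
    and sd2: "sym_diff (odd_letters (P @ Q)) ?y = odd_letters Q"
    "sym_diff ?y (odd_letters (Q @ R)) = odd_letters (P @ Q @ R)"
    "sym_diff (odd_letters Q) (odd_letters (Q @ R)) = odd_letters R"
    unfolding odd_letters_append by blast+
  have sub: "odd_letters (P @ Q @ R) \<subseteq> fst ?H" "?y \<subseteq> fst ?H" "odd_letters Q \<subseteq> fst ?H"
    "odd_letters (P @ Q) \<subseteq> fst ?H" "odd_letters (Q @ R) \<subseteq> fst ?H"
    by (rule sub; auto)+
  note rel1 = phi_6T[OF H sub(1,2,3) fresh(2,1,3-6) fresh(2,3,6) fresh(3,2) fresh(6)[symmetric], where k = False,
      unfolded sd1 not_False_eq_True, folded one split crossing]
  note rel2 = phi_6T[OF H sub(4,2,5) fresh(2,1,3-6) fresh(2,3,6) fresh(3,2) fresh(6)[symmetric], where k = True,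
      unfolded sd2 not_True_eq_False, folded two split nested]
  show "[:phi (intersection_graph ([a, b] @ P @ [c, a] @ Q @ [c] @ R @ [b] @ S)):]
        - [:phi (intersection_graph ([b, a] @ P @ [c, a] @ Q @ [c] @ R @ [b] @ S)):]
        - [:phi (intersection_graph ([a, b] @ P @ [a, c] @ Q @ [c] @ R @ [b] @ S)):]
        + [:phi (intersection_graph ([b, a] @ P @ [a, c] @ Q @ [c] @ R @ [b] @ S)):] =
      smult (1/2) [:phi (intersection_graph ([b] @ P @ [b] @ Q @ [c] @ R @ [c] @ S)):]
        - smult (1/2) [:phi (intersection_graph ([b] @ P @ [c] @ Q @ [b] @ R @ [c] @ S)):] \<and>
      [:phi (intersection_graph ([a, b] @ P @ [c, a] @ Q @ [b] @ R @ [c] @ S)):]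
        - [:phi (intersection_graph ([b, a] @ P @ [c, a] @ Q @ [b] @ R @ [c] @ S)):]
        - [:phi (intersection_graph ([a, b] @ P @ [a, c] @ Q @ [b] @ R @ [c] @ S)):]
        + [:phi (intersection_graph ([b, a] @ P @ [a, c] @ Q @ [b] @ R @ [c] @ S)):] =
      smult (1/2) [:phi (intersection_graph ([b] @ P @ [b] @ Q @ [c] @ R @ [c] @ S)):]
        - smult (1/2) [:phi (intersection_graph ([b] @ P @ [c] @ Q @ [c] @ R @ [b] @ S)):]"
    using rel1 rel2 by simp
qed

section \<open>Uniqueness of the weight system\<close>

text \<open>
  The relations in the form consumed by the recursion, with a parameter \<open>p\<close> in place of the
  variable of the polynomial ring, so that evaluating a weight system at a number yields (constant
  polynomials satisfying) relations of the same kind.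
\<close>

definition chord_CV_relations :: "complex poly \<Rightarrow> (nat list \<Rightarrow> complex poly) \<Rightarrow> bool" where
  "chord_CV_relations p w \<longleftrightarrow> w [] = 1 \<and>
     (\<forall>D k. chord_diagram D \<longrightarrow> w (rotate k D) = w D) \<and>
     (\<forall>a Y. chord_diagram ([a, a] @ Y) \<longrightarrow> w ([a, a] @ Y) = p * w Y) \<and>
     (\<forall>a x Y. chord_diagram ([a, x, a] @ Y) \<longrightarrow> w ([a, x, a] @ Y) = (p - [:1/2:]) * w ([x] @ Y)) \<and>
     chord_6T w"

lemma chord_diagram_rotate: "chord_diagram D \<Longrightarrow> chord_diagram (rotate k D)"
proof -
  have "count_list (rotate1 D) x = count_list D x" for D :: "nat list" and x
    by (cases D) simp_all
  then have "count_list (rotate k D) x = count_list D x" for x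
    by (induction k) simp_all
  then show "chord_diagram D \<Longrightarrow> chord_diagram (rotate k D)"
    by (simp add: chord_diagram_iff)
qed

text \<open>
  The recursion starts from a given diagram.  The freshness of its letters is therefore derived from
  the diagram here, which stands alone on the left.
\<close>

lemma chord_6T_first:
  assumes w: "chord_6T w" and D: "chord_diagram ([a, b] @ P @ [c, a] @ Q @ [c] @ R @ [b] @ S)"
  shows "w ([a, b] @ P @ [c, a] @ Q @ [c] @ R @ [b] @ S) =
    w ([b, a] @ P @ [c, a] @ Q @ [c] @ R @ [b] @ S) + w ([a, b] @ P @ [a, c] @ Q @ [c] @ R @ [b] @ S)
      - w ([b, a] @ P @ [a, c] @ Q @ [c] @ R @ [b] @ S)
      + smult (1/2) (w ([b] @ P @ [b] @ Q @ [c] @ R @ [c] @ S))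
      - smult (1/2) (w ([b] @ P @ [c] @ Q @ [b] @ R @ [c] @ S))"
proof -
  have "chord_diagram ([] @ [a] @ ([b] @ P @ [c]) @ [a] @ (Q @ [c] @ R @ [b] @ S))"
    using D by simp
  note a = iffD1[OF chord_diagram_add_chord this]
  have "chord_diagram ([] @ [b] @ (P @ [c] @ Q @ [c] @ R) @ [b] @ (S))"
    using a by simp
  note b = iffD1[OF chord_diagram_add_chord this]
  have "chord_diagram (P @ [c] @ (Q) @ [c] @ (R @ S))"
    using b by simp
  note c = iffD1[OF chord_diagram_add_chord this]
  have "chord_diagram (P @ Q @ R @ S)" "a \<notin> set (P @ Q @ R @ S)" "b \<notin> set (P @ Q @ R @ S)"
    "c \<notin> set (P @ Q @ R @ S)" "a \<noteq> b" "b \<noteq> c" "a \<noteq> c"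
    using a b c by auto
  from w[unfolded chord_6T_def, rule_format, OF conjI, OF this(1) conjI, OF this(2) conjI, OF this(3) conjI,
      OF this(4) conjI, OF this(5) conjI, OF this(6,7)]
  have "w ([a, b] @ P @ [c, a] @ Q @ [c] @ R @ [b] @ S) - w ([b, a] @ P @ [c, a] @ Q @ [c] @ R @ [b] @ S)
      - w ([a, b] @ P @ [a, c] @ Q @ [c] @ R @ [b] @ S) + w ([b, a] @ P @ [a, c] @ Q @ [c] @ R @ [b] @ S) =
    smult (1/2) (w ([b] @ P @ [b] @ Q @ [c] @ R @ [c] @ S))
      - smult (1/2) (w ([b] @ P @ [c] @ Q @ [b] @ R @ [c] @ S))"
    by (rule conjunct1)
  then show ?thesis
    by (simp only: algebra_simps)
qed

lemma chord_6T_second: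
  assumes w: "chord_6T w" and D: "chord_diagram ([a, b] @ P @ [c, a] @ Q @ [b] @ R @ [c] @ S)"
  shows "w ([a, b] @ P @ [c, a] @ Q @ [b] @ R @ [c] @ S) =
    w ([b, a] @ P @ [c, a] @ Q @ [b] @ R @ [c] @ S) + w ([a, b] @ P @ [a, c] @ Q @ [b] @ R @ [c] @ S)
      - w ([b, a] @ P @ [a, c] @ Q @ [b] @ R @ [c] @ S)
      + smult (1/2) (w ([b] @ P @ [b] @ Q @ [c] @ R @ [c] @ S))
      - smult (1/2) (w ([b] @ P @ [c] @ Q @ [c] @ R @ [b] @ S))"
proof -
  have "chord_diagram ([] @ [a] @ ([b] @ P @ [c]) @ [a] @ (Q @ [b] @ R @ [c] @ S))"
    using D by simp
  note a = iffD1[OF chord_diagram_add_chord this]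
  have "chord_diagram ([] @ [b] @ (P @ [c] @ Q) @ [b] @ (R @ [c] @ S))"
    using a by simp
  note b = iffD1[OF chord_diagram_add_chord this]
  have "chord_diagram (P @ [c] @ (Q @ R) @ [c] @ (S))"
    using b by simp
  note c = iffD1[OF chord_diagram_add_chord this]
  have "chord_diagram (P @ Q @ R @ S)" "a \<notin> set (P @ Q @ R @ S)" "b \<notin> set (P @ Q @ R @ S)"
    "c \<notin> set (P @ Q @ R @ S)" "a \<noteq> b" "b \<noteq> c" "a \<noteq> c"
    using a b c by auto
  from w[unfolded chord_6T_def, rule_format, OF conjI, OF this(1) conjI, OF this(2) conjI, OF this(3) conjI,
      OF this(4) conjI, OF this(5) conjI, OF this(6,7)]
  have "w ([a, b] @ P @ [c, a] @ Q @ [b] @ R @ [c] @ S) - w ([b, a] @ P @ [c, a] @ Q @ [b] @ R @ [c] @ S)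
      - w ([a, b] @ P @ [a, c] @ Q @ [b] @ R @ [c] @ S) + w ([b, a] @ P @ [a, c] @ Q @ [b] @ R @ [c] @ S) =
    smult (1/2) (w ([b] @ P @ [b] @ Q @ [c] @ R @ [c] @ S))
      - smult (1/2) (w ([b] @ P @ [c] @ Q @ [c] @ R @ [b] @ S))"
    by (rule conjunct2)
  then show ?thesis
    by (simp only: algebra_simps)
qed

text \<open>
  Outer induction on the number of chords, inner induction on the length of an arc \<open>X\<close> of a chord \<open>a\<close>
  that contains no chord with both ends.  Such an arc exists up to rotation: the first repetition of
  a letter in the word ends one.  Moving its outermost ends across \<open>a\<close> keeps the letters on the
  arc distinct.
\<close>

theorem chord_CV_relations_unique:
  assumes u: "chord_CV_relations p u" and v: "chord_CV_relations p v" and "chord_diagram D"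
  shows "u D = v D"
  using assms(3)
proof (induction "length D" arbitrary: D rule: less_induct)
  case less
  note rel = u[unfolded chord_CV_relations_def] v[unfolded chord_CV_relations_def]
  have rotate: "u (rotate k E) = u E" "v (rotate k E) = v E" if "chord_diagram E" for k E
    using rel that by blast+
  have shorter: "u E = v E" if "length E < length D" "chord_diagram E" for E
    using less.hyps that by blast
  have arc: "u ([a] @ X @ [a] @ Y) = v ([a] @ X @ [a] @ Y)"
    if "chord_diagram ([a] @ X @ [a] @ Y)" "distinct X" "length ([a] @ X @ [a] @ Y) = length D" for a X Y
    using that
  proof (induction "length X" arbitrary: X Y rule: less_induct)
    case (less X Y)
    have XY: "chord_diagram (X @ Y)" "a \<notin> set X" "a \<notin> set Y"
      using less.prems(1) chord_diagram_add_chord[of "[]" a X Y] by simp_all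
    consider "X = []" | x where "X = [x]" | b P c where "X = [b] @ P @ [c]"
    proof (cases X)
      case (Cons b X')
      then show ?thesis
        using that(2,3) by (cases X' rule: rev_cases) simp_all
    qed (use that(1) in simp)
    then show ?case
    proof cases
      case 1
      have "u Y = v Y"
        using XY less.prems by (intro shorter) (simp_all add: 1)
      then show ?thesis
        using rel less.prems(1) by (simp add: 1)
    next
      case (2 x)
      have "u ([x] @ Y) = v ([x] @ Y)"
        using XY less.prems by (intro shorter) (simp_all add: 2)
      then show ?thesis
        using rel less.prems(1) by (simp add: 2)
    next
      case (3 b P c)
      have bPc: "b \<noteq> c" "b \<notin> set P" "c \<notin> set P"
        using less.prems(2) by (auto simp: 3)
      have "count_list Y b = 1" "count_list Y c = 1"
        using XY(1)[unfolded chord_diagram_iff, rule_format, of b]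
          XY(1)[unfolded chord_diagram_iff, rule_format, of c] bPc by (simp_all add: 3 count_list_0_iff)
      then have "b \<in> set Y" "c \<in> set Y"
        by (metis count_list_0_iff zero_neq_one)+
      have rearranged: "chord_diagram E" if "\<And>x. count_list E x = count_list ([a] @ X @ [a] @ Y) x" for E
        using that less.prems(1) unfolding chord_diagram_iff by simp
      (* With the end of b moved out across a, the word begins with b; one rotation makes it begin
         with a again, now with a shorter arc. *)
      have ab: "u ([b, a] @ P @ [c, a] @ Y) = v ([b, a] @ P @ [c, a] @ Y)"
      proof -
        have dia: "chord_diagram ([b, a] @ P @ [c, a] @ Y)"
          by (rule rearranged) (simp add: 3)
        have rot: "rotate 1 ([b, a] @ P @ [c, a] @ Y) = [a] @ (P @ [c]) @ [a] @ (Y @ [b])"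
          by simp
        have "u ([a] @ (P @ [c]) @ [a] @ (Y @ [b])) = v ([a] @ (P @ [c]) @ [a] @ (Y @ [b]))"
          using less.prems(2,3) chord_diagram_rotate[OF dia, of 1] unfolding rot
          by (intro less.hyps) (simp_all add: 3)
        then show ?thesis
          using rotate[OF dia, of 1] unfolding rot by simp
      qed
      have ac: "u ([a, b] @ P @ [a, c] @ Y) = v ([a, b] @ P @ [a, c] @ Y)"
      proof -
        have "chord_diagram ([a] @ ([b] @ P) @ [a] @ ([c] @ Y))"
          by (rule rearranged) (simp add: 3)
        then have "u ([a] @ ([b] @ P) @ [a] @ ([c] @ Y)) = v ([a] @ ([b] @ P) @ [a] @ ([c] @ Y))"
          using less.prems(2,3) by (intro less.hyps) (simp_all add: 3)
        then show ?thesis by simp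
      qed
      have abc: "u ([b, a] @ P @ [a, c] @ Y) = v ([b, a] @ P @ [a, c] @ Y)"
      proof -
        have dia: "chord_diagram ([b, a] @ P @ [a, c] @ Y)"
          by (rule rearranged) (simp add: 3)
        have rot: "rotate 1 ([b, a] @ P @ [a, c] @ Y) = [a] @ P @ [a] @ ([c] @ Y @ [b])"
          by simp
        have "u ([a] @ P @ [a] @ ([c] @ Y @ [b])) = v ([a] @ P @ [a] @ ([c] @ Y @ [b]))"
          using less.prems(2,3) chord_diagram_rotate[OF dia, of 1] unfolding rot
          by (intro less.hyps) (simp_all add: 3)
        then show ?thesis
          using rotate[OF dia, of 1] unfolding rot by simp
      qed
      (* The two remaining terms of the 6T-relation have the letters of X @ Y: the chord a is gone. *)
      have fewer: "u E = v E" if "\<And>x. count_list E x = count_list (X @ Y) x" "length E = length (X @ Y)" for E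
        using that XY(1) less.prems(3) by (intro shorter) (simp_all add: chord_diagram_iff)
      consider Q R S where "Y = Q @ [c] @ R @ [b] @ S" | Q R S where "Y = Q @ [b] @ R @ [c] @ S"
      proof -
        obtain Q Z where Y: "Y = Q @ b # Z"
          using \<open>b \<in> set Y\<close> by (auto dest: split_list)
        then consider "c \<in> set Q" | "c \<in> set Z"
          using \<open>c \<in> set Y\<close> bPc(1) by auto
        then show thesis
        proof cases
          case 1
          then obtain Q' R where "Q = Q' @ c # R" by (auto dest: split_list)
          with Y that(1)[of Q' R Z] show thesis by simp
        next
          case 2
          then obtain R S where "Z = R @ c # S" by (auto dest: split_list)
          with Y that(2)[of Q R S] show thesis by simp
        qed
      qed
      then obtain E E' where six: "\<And>w. chord_6T w \<Longrightarrow>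
          w ([a] @ X @ [a] @ Y) = w ([b, a] @ P @ [c, a] @ Y) + w ([a, b] @ P @ [a, c] @ Y)
            - w ([b, a] @ P @ [a, c] @ Y) + smult (1/2) (w E) - smult (1/2) (w E')"
        and E: "u E = v E" "u E' = v E'"
      proof cases
        case Y: (1 Q R S)
        have "w ([a] @ X @ [a] @ Y) = w ([b, a] @ P @ [c, a] @ Y) + w ([a, b] @ P @ [a, c] @ Y)
              - w ([b, a] @ P @ [a, c] @ Y) + smult (1/2) (w ([b] @ P @ [b] @ Q @ [c] @ R @ [c] @ S))
              - smult (1/2) (w ([b] @ P @ [c] @ Q @ [b] @ R @ [c] @ S))"
          if "chord_6T w" for w
          using chord_6T_first[OF that, of a b P c Q R S] less.prems(1) by (simp add: 3 Y)
        moreover have "u ([b] @ P @ [b] @ Q @ [c] @ R @ [c] @ S) = v ([b] @ P @ [b] @ Q @ [c] @ R @ [c] @ S)"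
          "u ([b] @ P @ [c] @ Q @ [b] @ R @ [c] @ S) = v ([b] @ P @ [c] @ Q @ [b] @ R @ [c] @ S)"
          by (rule fewer; simp add: 3 Y)+
        ultimately show thesis by (rule that)
      next
        case Y: (2 Q R S)
        have "w ([a] @ X @ [a] @ Y) = w ([b, a] @ P @ [c, a] @ Y) + w ([a, b] @ P @ [a, c] @ Y)
              - w ([b, a] @ P @ [a, c] @ Y) + smult (1/2) (w ([b] @ P @ [b] @ Q @ [c] @ R @ [c] @ S))
              - smult (1/2) (w ([b] @ P @ [c] @ Q @ [c] @ R @ [b] @ S))"
          if "chord_6T w" for w
          using chord_6T_second[OF that, of a b P c Q R S] less.prems(1) by (simp add: 3 Y)
        moreover have "u ([b] @ P @ [b] @ Q @ [c] @ R @ [c] @ S) = v ([b] @ P @ [b] @ Q @ [c] @ R @ [c] @ S)"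
          "u ([b] @ P @ [c] @ Q @ [c] @ R @ [b] @ S) = v ([b] @ P @ [c] @ Q @ [c] @ R @ [b] @ S)"
          by (rule fewer; simp add: 3 Y)+
        ultimately show thesis by (rule that)
      qed
      have "chord_6T u" "chord_6T v"
        using rel by blast+
      then show ?thesis
        by (simp only: six ab ac abc E)
    qed
  qed
  show ?case
  proof (cases "D = []")
    case True
    then show ?thesis using rel by simp
  next
    case False
    have "\<not> distinct D"
    proof
      assume "distinct D"
      moreover obtain a where "a \<in> set D" using False by (cases D) auto
      moreover from this have "{x. a = x} \<inter> set D = {a}" by auto
      ultimately have "count_list D a = 1"
        by (simp add: count_list_eq_length_filter distinct_length_filter)
      then show False
        using less.prems[unfolded chord_diagram_iff, rule_format, of a] by simp
    qed
    then obtain xs a ys where D: "D = xs @ a # ys" "a \<in> set xs" "distinct xs"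
      unfolding not_distinct_conv_prefix by blast
    then obtain Z X where xs: "xs = Z @ a # X"
      by (auto dest: split_list)
    have rot: "rotate (length Z) D = [a] @ X @ [a] @ (ys @ Z)"
      unfolding D(1) xs by (simp add: rotate_append)
    have "u ([a] @ X @ [a] @ (ys @ Z)) = v ([a] @ X @ [a] @ (ys @ Z))"
      using chord_diagram_rotate[OF less.prems, of "length Z"] D(3) unfolding rot
      by (intro arc) (simp_all add: D(1) xs)
    then show ?thesis
      using rotate[OF less.prems, of "length Z"] unfolding rot by simp
  qed
qed

section \<open>The weight system on intersection graphs\<close>

lemma chord_CV_relations_weight_system:
  assumes w: "sl2_weight_system w"
  shows "chord_CV_relations [:0, 1:] w"
  unfolding chord_CV_relations_def
proof (intro conjI allI impI)
  have chord: "w [a, a] = [:0, 1:]" for a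
    using w unfolding sl2_weight_system_def by blast
  have mult: "w (D1 @ D2) = w D1 * w D2"
    if "chord_diagram D1" "chord_diagram D2" "set D1 \<inter> set D2 = {}" for D1 D2
    using w that unfolding sl2_weight_system_def by blast
  have one_chord: "chord_diagram [a, a]" for a
    by (simp add: chord_diagram_def)
  have "w ([0, 0] @ []) = w [0, 0] * w []"
    by (rule mult[OF one_chord]) (simp_all add: chord_diagram_def)
  then show "w [] = 1" by (simp add: chord del: mult_pCons_left)
  show "w (rotate k D) = w D" if "chord_diagram D" for D k
  proof -
    have "same_diagram D (rotate k D)"
      unfolding same_diagram_def by (rule exI[of _ id], rule exI[of _ k]) simp
    then show ?thesis
      using w that chord_diagram_rotate[OF that]
      unfolding sl2_weight_system_def diagram_function_def by metis
  qed
  show "w ([a, a] @ Y) = [:0, 1:] * w Y" if "chord_diagram ([a, a] @ Y)" for a Y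
  proof -
    have "chord_diagram Y \<and> a \<notin> set Y"
      using chord_diagram_add_chord[of "[]" a "[]" Y] that by simp
    then show ?thesis
      using mult[OF one_chord, of Y a] by (simp add: chord)
  qed
  show "w ([a, x, a] @ Y) = ([:0, 1:] - [:1/2:]) * w ([x] @ Y)" if D: "chord_diagram ([a, x, a] @ Y)" for a x Y
  proof -
    have "chord_diagram ([] @ [a] @ [x] @ [a] @ Y)" using D by simp
    note split = chords_intersect_iff_odd[OF this] iffD1[OF chord_diagram_add_chord this]
    have "{b. chords_intersect ([a, x, a] @ Y) a b} = {x}"
      using split(1) by (auto simp: odd_letters_def)
    moreover have "removeAll a ([a, x, a] @ Y) = [x] @ Y"
      using split(2) by (auto simp: removeAll_id)
    ultimately show ?thesis
      using w D unfolding sl2_weight_system_def by (metis append_Cons card_1_singleton_iff list.set_intros(1) One_nat_def)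
  qed
  show "chord_6T w"
    using w unfolding sl2_weight_system_def by blast
qed

lemma chord_CV_relations_evaluate:
  assumes "chord_CV_relations p w"
  shows "chord_CV_relations [:poly p x:] (\<lambda>D. [:poly (w D) x:])"
  unfolding chord_CV_relations_def
proof (intro conjI)
  show "chord_6T (\<lambda>D. [:poly (w D) x:])"
    unfolding chord_6T_def
  proof (intro allI impI, goal_cases)
    case (1 P Q R S a b c)
    with assms have "chord_6T w" by (simp add: chord_CV_relations_def)
    note rel = this[unfolded chord_6T_def, rule_format, OF 1]
    from rel[THEN conjunct1, THEN arg_cong[where f = "\<lambda>q. poly q x"]]
      rel[THEN conjunct2, THEN arg_cong[where f = "\<lambda>q. poly q x"]]
    show ?case by simp
  qed
qed (use assms in \<open>simp_all add: chord_CV_relations_def\<close>)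

lemma chord_CV_relations_phi: "chord_CV_relations [:3/8:] (\<lambda>D. [:phi (intersection_graph D):])"
  unfolding chord_CV_relations_def
proof (intro conjI allI impI)
  show "[:phi (intersection_graph []):] = 1"
    by (simp add: intersection_graph_def chords_intersect_def phi_empty_graph)
  show "[:phi (intersection_graph (rotate k D)):] = [:phi (intersection_graph D):]" for k D
    by (simp add: intersection_graph_rotate)
  show "[:phi (intersection_graph ([a, a] @ Y)):] = [:3/8:] * [:phi (intersection_graph Y):]"
    if D: "chord_diagram ([a, a] @ Y)" for a Y
  proof -
    have "chord_diagram ([] @ [a] @ [] @ [a] @ Y)" using D by simp
    note graph = intersection_graph_add_chord[OF this] and Y = iffD1[OF chord_diagram_add_chord this]
    have "a \<notin> fst (intersection_graph Y)" using Y by (simp add: intersection_graph_def)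
    with graph Y show ?thesis
      by (simp add: phi_isolated_vertex simple_graph_intersection_graph)
  qed
  show "[:phi (intersection_graph ([a, x, a] @ Y)):] = ([:3/8:] - [:1/2:]) * [:phi (intersection_graph ([x] @ Y)):]"
    if D: "chord_diagram ([a, x, a] @ Y)" for a x Y
  proof -
    have "chord_diagram ([] @ [a] @ [x] @ [a] @ Y)" using D by simp
    note graph = intersection_graph_add_chord[OF this] and xY = iffD1[OF chord_diagram_add_chord this]
    have "a \<notin> fst (intersection_graph ([x] @ Y))" "x \<in> fst (intersection_graph ([x] @ Y))"
      using xY by (simp_all add: intersection_graph_def)
    then have "phi (add_vertex a {x} (intersection_graph ([x] @ Y))) =
        (3/8 - 1/2) * phi (intersection_graph ([x] @ Y))"
      using xY simple_graph_intersection_graph[of "[x] @ Y"] by (intro phi_leaf) simp_all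
    moreover have "odd_letters [x] = {x}"
      by (auto simp: odd_letters_def)
    ultimately show ?thesis
      using graph by simp
  qed
  show "chord_6T (\<lambda>D. [:phi (intersection_graph D):])" by (rule chord_6T_phi)
qed

theorem theorem3p9:
  shows "four_invariant phi \<and> graph_CV_relations (3/8) phi \<and>
    (\<forall>w. sl2_weight_system w \<longrightarrow>
      (\<forall>D. chord_diagram D \<longrightarrow> phi (intersection_graph D) = poly (w D) (3/8)))"
proof (intro conjI allI impI)
  show "four_invariant phi" by (rule four_invariant_phi)
  show "graph_CV_relations (3/8) phi" by (rule graph_CV_relations_phi)
next
  fix w D assume "sl2_weight_system w" "chord_diagram D"
  then have "[:phi (intersection_graph D):] = [:poly (w D) (3/8):]"
    using chord_CV_relations_unique[OF chord_CV_relations_phi, of "\<lambda>D. [:poly (w D) (3/8):]" D]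
      chord_CV_relations_evaluate[OF chord_CV_relations_weight_system, of w "3/8"] by simp
  then show "phi (intersection_graph D) = poly (w D) (3/8)" by simp
qed

end
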